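(* Let $X$ be a curve of genus $g$ over a finite field $\mathbb{F}$, let $C$ be a divisor on $X$ and let $P$ be a rational point of $X$. Let $A_1 \leq A_2 \leq \cdots \leq A_w$ be divisors with $A_{i+1} \geq A_i + P$ for $i=1,\ldots,w-1$, such that each $A_i$ lies in $\Delta_P(C)$, i.e. $L(A_i)\neq L(A_i-P)$ and $L(A_i-C)=L(A_i-C-P)$. Then every divisor $A$ with $L(A)\neq L(A-P)$ and $L(A-C)\neq L(A-C-P)$ (i.e. $A\in\Gamma_P(C)$) whose support is disjoint from the support of $A_w-A_1$ satisfies $\deg A \geq w$. In the paper's notation, $\gamma_P(C;A_w-A_1)\geq w$.
   Context: $X$ is an absolutely irreducible, smooth, projective curve of genus $g$ over a finite field $\mathbb{F}$. For a divisor $E$, $L(E)=\{f\in\mathbb{F}(X)^\times : (f)+E\geq 0\}\cup\{0\}$. For a rational point $P$, $\Gamma_P$ denotes the set of divisors (classes) $A$ with $L(A)\neq L(A-P)$; for a divisor $C$, $\Gamma_P(C)=\{A\in\Gamma_P : A-C\in\Gamma_P\}$ and $\Delta_P(C)=\{A\in\Gamma_P : A-C\notin\Gamma_P\}$. For a set of points $S$, $\Gamma_S=\bigcap_{Q\in S}\Gamma_Q$ and $\gamma_P(C;S)$ denotes the minimal degree of a divisor in $\Gamma_P(C)$ subject to the restriction indicated by $S$; here the restriction is that $A$ has support disjoint from $A_w-A_1$.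
   Formalization: The bound fails for arbitrary A with support disjoint from A_w−A_1 (genus 1, C=Q, A_1=0, A_2=P+Q, A∼Q). It is proved for effective such A, and for all A∈Γ_P(C) with L(A)≠L(A−Q) at every Q in supp(A_w−A_1); γ_P(C;A_w−A_1) is meant in this last sense. *)

theory Defs
  imports
    "HOL-Computational_Algebra.Polynomial"
    "HOL-Library.Function_Algebras"
    "HOL-Library.Extended_Real"
begin

text \<open>
  An absolutely irreducible, smooth, projective curve \<open>X\<close> over a finite field is given by its
  function field: the type \<open>'a\<close> is the field \<open>F(X)\<close> of rational functions and \<open>F\<close> is the
  constant field inside it.  The closed points of \<open>X\<close> are the discrete valuations of \<open>F(X)/F\<close>.
\<close>

definition subfield_set :: "'a::field set \<Rightarrow> bool" where
  "subfield_set F \<longleftrightarrow> 0 \<in> F \<and> 1 \<in> F \<and>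
     (\<forall>x\<in>F. \<forall>y\<in>F. x - y \<in> F \<and> x * y \<in> F) \<and> (\<forall>x\<in>F. inverse x \<in> F)"

definition algebraic_over :: "'a::field set \<Rightarrow> 'a \<Rightarrow> bool" where
  "algebraic_over F x \<longleftrightarrow> (\<exists>p. p \<noteq> 0 \<and> (\<forall>i. coeff p i \<in> F) \<and> poly p x = 0)"

definition simple_ext :: "'a::field set \<Rightarrow> 'a \<Rightarrow> 'a set" where
  "simple_ext F x = {poly p x / poly q x | p q.
     (\<forall>i. coeff p i \<in> F) \<and> (\<forall>i. coeff q i \<in> F) \<and> poly q x \<noteq> 0}"

definition span_over :: "'a::field set \<Rightarrow> 'a set \<Rightarrow> 'a set" where
  "span_over F B = {(\<Sum>b\<in>B. c b * b) | c. \<forall>b\<in>B. c b \<in> F}"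

text \<open>
  Since a finite field is perfect, absolute irreducibility amounts to \<open>F\<close> being
  algebraically closed in \<open>F(X)\<close>.
\<close>

definition curve_over :: "'a::field set \<Rightarrow> bool" where
  "curve_over F \<longleftrightarrow> finite F \<and> subfield_set F \<and>
     (\<forall>x. algebraic_over F x \<longrightarrow> x \<in> F) \<and>
     (\<exists>x. \<not> algebraic_over F x \<and> (\<exists>B. finite B \<and> span_over (simple_ext F x) B = UNIV))"

text \<open>
  The value \<open>v 0\<close>, mathematically infinite, is set to \<open>0\<close>, so that different functions are
  different points; it is never used.
\<close>

definition points :: "'a::field set \<Rightarrow> ('a \<Rightarrow> int) set" where
  "points F = {v. v 0 = 0 \<and>
     (\<forall>x y. x \<noteq> 0 \<longrightarrow> y \<noteq> 0 \<longrightarrow> v (x * y) = v x + v y) \<and>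
     (\<forall>x y. x \<noteq> 0 \<longrightarrow> y \<noteq> 0 \<longrightarrow> x + y \<noteq> 0 \<longrightarrow> min (v x) (v y) \<le> v (x + y)) \<and>
     (\<forall>c\<in>F. c \<noteq> 0 \<longrightarrow> v c = 0) \<and>
     (\<exists>t. t \<noteq> 0 \<and> v t = 1)}"

text \<open>
  The dimension of \<open>V/W\<close> over \<open>F\<close>, as the least size of a spanning set.  It is only used
  where this dimension is finite.
\<close>

definition quot_dim :: "'a::field set \<Rightarrow> 'a set \<Rightarrow> 'a set \<Rightarrow> nat" where
  "quot_dim F V W = (LEAST n. \<exists>B. B \<subseteq> V \<and> finite B \<and> card B = n \<and>
     (\<forall>x\<in>V. \<exists>s\<in>span_over F B. x - s \<in> W))"

definition local_ring :: "('a::field \<Rightarrow> int) \<Rightarrow> 'a set" where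
  "local_ring v = {x. x = 0 \<or> v x \<ge> 0}"

definition max_ideal :: "('a::field \<Rightarrow> int) \<Rightarrow> 'a set" where
  "max_ideal v = {x. x = 0 \<or> v x > 0}"

definition point_degree :: "'a::field set \<Rightarrow> ('a \<Rightarrow> int) \<Rightarrow> nat" where
  "point_degree F v = quot_dim F (local_ring v) (max_ideal v)"

definition rational_point :: "'a::field set \<Rightarrow> ('a \<Rightarrow> int) \<Rightarrow> bool" where
  "rational_point F P \<longleftrightarrow> P \<in> points F \<and> point_degree F P = 1"

text \<open>
  Divisors are integer-valued functions on points, with pointwise addition and order.
\<close>

type_synonym 'a divisor = "('a \<Rightarrow> int) \<Rightarrow> int"

definition supp :: "'a divisor \<Rightarrow> ('a \<Rightarrow> int) set" where
  "supp D = {v. D v \<noteq> 0}"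

definition divisors :: "'a::field set \<Rightarrow> 'a divisor set" where
  "divisors F = {D. finite (supp D) \<and> supp D \<subseteq> points F}"

definition point_div :: "('a \<Rightarrow> int) \<Rightarrow> 'a divisor" where
  "point_div P = (\<lambda>v. if v = P then 1 else 0)"

definition principal_div :: "'a::field set \<Rightarrow> 'a \<Rightarrow> 'a divisor" where
  "principal_div F f = (\<lambda>v. if v \<in> points F then v f else 0)"

definition div_degree :: "'a::field set \<Rightarrow> 'a divisor \<Rightarrow> int" where
  "div_degree F D = (\<Sum>v\<in>supp D. D v * int (point_degree F v))"

definition RR_space :: "'a::field set \<Rightarrow> 'a divisor \<Rightarrow> 'a set" where
  "RR_space F E = {f. f \<noteq> 0 \<and> principal_div F f + E \<ge> 0} \<union> {0}"

definition has_genus :: "'a::field set \<Rightarrow> nat \<Rightarrow> bool" where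
  "has_genus F g \<longleftrightarrow>
     (\<forall>E\<in>divisors F. div_degree F E - int (quot_dim F (RR_space F E) {0}) + 1 \<le> int g) \<and>
     (\<exists>E\<in>divisors F. div_degree F E - int (quot_dim F (RR_space F E) {0}) + 1 = int g)"

definition Gamma_pt :: "'a::field set \<Rightarrow> ('a \<Rightarrow> int) \<Rightarrow> 'a divisor set" where
  "Gamma_pt F P = {A \<in> divisors F. RR_space F A \<noteq> RR_space F (A - point_div P)}"

definition Gamma_set :: "'a::field set \<Rightarrow> ('a \<Rightarrow> int) set \<Rightarrow> 'a divisor set" where
  "Gamma_set F S = {A \<in> divisors F. \<forall>Q\<in>S. A \<in> Gamma_pt F Q}"

definition Gamma_rel :: "'a::field set \<Rightarrow> ('a \<Rightarrow> int) \<Rightarrow> 'a divisor \<Rightarrow> 'a divisor set" where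
  "Gamma_rel F P C = {A \<in> Gamma_pt F P. A - C \<in> Gamma_pt F P}"

definition Delta_rel :: "'a::field set \<Rightarrow> ('a \<Rightarrow> int) \<Rightarrow> 'a divisor \<Rightarrow> 'a divisor set" where
  "Delta_rel F P C = {A \<in> Gamma_pt F P. A - C \<notin> Gamma_pt F P}"

text \<open>
  The restriction indicated by \<open>S\<close> must be stable under linear equivalence, as \<open>Gamma_rel F P C\<close>
  is.  An effective divisor whose support is disjoint from \<open>S\<close> lies in \<open>Gamma_set F S\<close>,
  because the constant function \<open>1\<close> does not vanish at the points of \<open>S\<close>.  Disjointness of
  supports alone would be no restriction: every divisor is linearly equivalent to one whose
  support avoids a given finite set of points.
\<close>

definition gamma_min ::
  "'a::field set \<Rightarrow> ('a \<Rightarrow> int) \<Rightarrow> 'a divisor \<Rightarrow> ('a \<Rightarrow> int) set \<Rightarrow> ereal" where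
  "gamma_min F P C S =
     (INF A \<in> Gamma_rel F P C \<inter> Gamma_set F S. ereal (real_of_int (div_degree F A)))"

end

theory Submission
  imports Defs "HOL-Library.FuncSet"
begin

text \<open>
  Let \<open>B\<close> be in \<open>\<Gamma>\<^sub>P(C)\<close> and \<open>\<Gamma>\<^sub>S\<close>, where \<open>S\<close> is the support of \<open>A\<^sub>w - A\<^sub>1\<close>.  Since
  \<open>\<Gamma>\<^sub>P\<close> is a semigroup, \<open>A\<^sub>i - C \<notin> \<Gamma>\<^sub>P\<close> and \<open>B - C \<in> \<Gamma>\<^sub>P\<close> give \<open>A\<^sub>i - B \<notin> \<Gamma>\<^sub>P\<close>.  The ratio
  \<open>r(A) = |L(A)| / |L(A - B)|\<close> therefore grows by the factor \<open>q = |F|\<close> from \<open>A\<^sub>i - P\<close> to \<open>A\<^sub>i\<close>.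
  It does not decrease from \<open>A\<close> to \<open>A + Q\<close> for \<open>Q \<in> S\<close>, because a function in \<open>L(B)\<close> of exact order
  at \<open>Q\<close> embeds \<open>L(A + Q - B)/L(A - B)\<close> into \<open>L(A + Q)/L(A)\<close>.  Finally \<open>1 \<le> r(A) \<le> q\<^bsup>deg B\<^esup>\<close>,
  as \<open>B\<close> is linearly equivalent to an effective divisor; hence \<open>q\<^bsup>w\<^esup> \<le> q\<^bsup>deg B\<^esup>\<close>.

  The facts on degrees that this needs follow from Riemann's inequality, which is part of
  the definition of the genus, together with the finiteness of residue fields.
\<close>

section \<open>Counting\<close>

lemma card_le_fibres:
  assumes "finite T" "\<phi> ` X \<subseteq> T"
    and "\<And>t. t \<in> T \<Longrightarrow> finite {x \<in> X. \<phi> x = t} \<and> card {x \<in> X. \<phi> x = t} \<le> N"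
  shows "finite X" "card X \<le> card T * N"
proof -
  have eq: "X = (\<Union>t\<in>T. {x \<in> X. \<phi> x = t})"
    using assms(2) by auto
  show "finite X"
    by (subst eq) (use assms in auto)
  have "card X \<le> (\<Sum>t\<in>T. card {x \<in> X. \<phi> x = t})"
    by (subst eq, rule card_UN_le) (rule assms(1))
  also have "\<dots> \<le> (\<Sum>t\<in>T. N)"
    by (rule sum_mono) (use assms(3) in auto)
  finally show "card X \<le> card T * N" by simp
qed

text \<open>Translation by a fixed member of a fibre of \<open>\<phi>\<close> embeds that fibre into
  \<open>H\<close>. Here \<open>\<phi>\<close> need not be additive, so it may pick arbitrary
  residue representatives.\<close>

lemma card_le_cosets:
  fixes G H :: "'b::group_add set"
  assumes "finite T" "\<phi> ` G \<subseteq> T" "finite H"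
    and "\<And>x y. x \<in> G \<Longrightarrow> y \<in> G \<Longrightarrow> \<phi> x = \<phi> y \<Longrightarrow> x - y \<in> H"
  shows "finite G" "card G \<le> card T * card H"
proof -
  have "finite {x \<in> G. \<phi> x = t} \<and> card {x \<in> G. \<phi> x = t} \<le> card H" for t
  proof (cases "{x \<in> G. \<phi> x = t} = {}")
    case False
    then obtain y where y: "y \<in> G" "\<phi> y = t" by auto
    have inj: "inj_on (\<lambda>x. x - y) {x \<in> G. \<phi> x = t}"
      by (auto simp: inj_on_def)
    have sub: "(\<lambda>x. x - y) ` {x \<in> G. \<phi> x = t} \<subseteq> H"
      using assms(4) y by auto
    show ?thesis
      using inj_on_finite[OF inj sub assms(3)] card_inj_on_le[OF inj sub assms(3)] by simp
  next
    case True
    show ?thesis by (simp only: True) simp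
  qed
  then show "finite G" "card G \<le> card T * card H"
    using card_le_fibres[OF assms(1,2)] by blast+
qed

lemma finite_card_span_over:
  assumes "finite F" "finite B"
  shows "finite (span_over F B)" "card (span_over F B) \<le> card F ^ card B"
proof -
  have eq: "span_over F B = (\<lambda>c. \<Sum>b\<in>B. c b * b) ` (B \<rightarrow>\<^sub>E F)" (is "?L = ?f ` _")
  proof (intro equalityI subsetI)
    fix y assume "y \<in> ?L"
    then obtain c where c: "y = (\<Sum>b\<in>B. c b * b)" "\<forall>b\<in>B. c b \<in> F"
      by (auto simp: span_over_def)
    then have "y = ?f (restrict c B)" "restrict c B \<in> B \<rightarrow>\<^sub>E F"
      by auto
    then show "y \<in> ?f ` (B \<rightarrow>\<^sub>E F)" by blast
  next
    fix y assume "y \<in> ?f ` (B \<rightarrow>\<^sub>E F)"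
    then show "y \<in> ?L" by (auto simp: span_over_def)
  qed
  have fin: "finite (B \<rightarrow>\<^sub>E F)"
    using assms by (simp add: finite_PiE)
  show "finite (span_over F B)"
    by (simp add: eq fin)
  show "card (span_over F B) \<le> card F ^ card B"
    using card_image_le[OF fin, of ?f] assms by (simp add: eq card_PiE)
qed

lemma span_over_superset:
  assumes "subfield_set F" "finite B"
  shows "B \<subseteq> span_over F B"
proof
  fix b assume "b \<in> B"
  then have "b = (\<Sum>a\<in>B. (if a = b then 1 else 0) * a)"
    using assms(2) by (simp add: if_distrib[of "\<lambda>c. c * _"] cong: if_cong)
  moreover have "\<forall>a\<in>B. (if a = b then 1 else 0) \<in> F"
    using assms(1) by (simp add: subfield_set_def)
  ultimately show "b \<in> span_over F B"
    unfolding span_over_def by (intro CollectI exI[of _ "\<lambda>a. if a = b then 1 else 0"]) blast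
qed

section \<open>Points\<close>

lemma subfield_setD:
  assumes "subfield_set F"
  shows "0 \<in> F" "1 \<in> F" "x \<in> F \<Longrightarrow> y \<in> F \<Longrightarrow> x - y \<in> F" "x \<in> F \<Longrightarrow> y \<in> F \<Longrightarrow> x * y \<in> F"
    "x \<in> F \<Longrightarrow> inverse x \<in> F" "x \<in> F \<Longrightarrow> - x \<in> F" "x \<in> F \<Longrightarrow> y \<in> F \<Longrightarrow> x + y \<in> F"
proof -
  note * = assms[unfolded subfield_set_def]
  show "0 \<in> F" "1 \<in> F" and d: "x \<in> F \<Longrightarrow> y \<in> F \<Longrightarrow> x - y \<in> F" for x y
    using * by auto
  show "x \<in> F \<Longrightarrow> y \<in> F \<Longrightarrow> x * y \<in> F" "x \<in> F \<Longrightarrow> inverse x \<in> F"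
    using * by auto
  have m: "x \<in> F \<Longrightarrow> - x \<in> F" for x
    using d[of 0 x] * by auto
  then show "x \<in> F \<Longrightarrow> - x \<in> F" .
  show "x \<in> F \<Longrightarrow> y \<in> F \<Longrightarrow> x + y \<in> F"
    using d[of x "- y"] m[of y] by simp
qed

locale function_field =
  fixes F :: "'a::field set"
  assumes curve: "curve_over F"
begin

lemma finite_F: "finite F" and subfield_F: "subfield_set F"
  using curve by (auto simp: curve_over_def)

lemmas F_closed = subfield_setD[OF subfield_F]

lemma card_F_gt_1: "card F > 1"
proof -
  have "card {0, 1::'a} \<le> card F"
    using F_closed(1,2) finite_F by (intro card_mono) auto
  then show ?thesis by simp
qed

definition val_ge :: "('a \<Rightarrow> int) \<Rightarrow> int \<Rightarrow> 'a set" where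
  "val_ge v n = {x. x = 0 \<or> v x \<ge> n}"

context
  fixes v assumes v: "v \<in> points F"
begin

lemma v_mult: "x \<noteq> 0 \<Longrightarrow> y \<noteq> 0 \<Longrightarrow> v (x * y) = v x + v y"
  and v_const: "c \<in> F \<Longrightarrow> c \<noteq> 0 \<Longrightarrow> v c = 0"
  and v_uniformizer: "\<exists>t. t \<noteq> 0 \<and> v t = 1"
  and v_add: "x \<noteq> 0 \<Longrightarrow> y \<noteq> 0 \<Longrightarrow> x + y \<noteq> 0 \<Longrightarrow> min (v x) (v y) \<le> v (x + y)"
  using v by (auto simp: points_def)

lemma v_one: "v 1 = 0"
  using v_const F_closed(2) by simp

lemma v_inverse: "x \<noteq> 0 \<Longrightarrow> v (inverse x) = - v x"
  using v_mult[of x "inverse x"] v_one by simp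

lemma v_divide: "x \<noteq> 0 \<Longrightarrow> y \<noteq> 0 \<Longrightarrow> v (x / y) = v x - v y"
  using v_mult[of x "inverse y"] v_inverse[of y] by (simp add: divide_inverse)

lemma v_power: "x \<noteq> 0 \<Longrightarrow> v (x ^ n) = int n * v x"
  by (induction n) (auto simp: v_one v_mult algebra_simps)

lemma v_minus: "x \<noteq> 0 \<Longrightarrow> v (- x) = v x"
  using v_mult[of "-1" x] v_const[of "-1"] F_closed(2) F_closed(6)[of 1] by simp

lemma val_ge_add: "x \<in> val_ge v n \<Longrightarrow> y \<in> val_ge v n \<Longrightarrow> x + y \<in> val_ge v n"
  using v_add[of x y] by (cases "x = 0 \<or> y = 0 \<or> x + y = 0") (auto simp: val_ge_def)

lemma val_ge_minus: "x \<in> val_ge v n \<Longrightarrow> - x \<in> val_ge v n"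
  using v_minus[of x] by (cases "x = 0") (auto simp: val_ge_def)

lemma val_ge_diff: "x \<in> val_ge v n \<Longrightarrow> y \<in> val_ge v n \<Longrightarrow> x - y \<in> val_ge v n"
  using val_ge_add[of x n "- y"] val_ge_minus[of y] by simp

lemma val_ge_mult: "x \<in> val_ge v m \<Longrightarrow> y \<in> val_ge v n \<Longrightarrow> x * y \<in> val_ge v (m + n)"
  using v_mult[of x y] by (cases "x = 0 \<or> y = 0") (auto simp: val_ge_def)

lemma val_ge_mult_iff: "x \<noteq> 0 \<Longrightarrow> x * y \<in> val_ge v (v x + n) \<longleftrightarrow> y \<in> val_ge v n"
  using v_mult[of x y] by (cases "x = 0 \<or> y = 0") (auto simp: val_ge_def)

lemma val_ge_const: "c \<in> F \<Longrightarrow> c \<in> val_ge v 0"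
  using v_const[of c] by (cases "c = 0") (auto simp: val_ge_def)

lemma val_ge_mono: "m \<le> n \<Longrightarrow> val_ge v n \<subseteq> val_ge v m"
  by (auto simp: val_ge_def)

lemma val_ge_sum: "(\<And>i. i \<in> I \<Longrightarrow> h i \<in> val_ge v n) \<Longrightarrow> sum h I \<in> val_ge v n"
proof (induction I rule: infinite_finite_induct)
  case (insert i I)
  then show ?case by (auto intro: val_ge_add)
qed (auto simp: val_ge_def)

lemma local_ring_eq: "local_ring v = val_ge v 0" and max_ideal_eq: "max_ideal v = val_ge v 1"
  by (auto simp: local_ring_def max_ideal_def val_ge_def)

text \<open>The leading digit in which two expansions differ determines the valuation of their
  difference.\<close>

lemma digit_sums_distinct:
  fixes a b :: "nat \<Rightarrow> 'a"
  assumes u: "u \<noteq> 0" "v u \<ge> 1"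
    and dig: "\<And>k. k < M \<Longrightarrow> a k \<in> val_ge v 0 \<and> b k \<in> val_ge v 0 \<and> (a k - b k \<in> val_ge v 1 \<longrightarrow> a k = b k)"
    and eq: "(\<Sum>k<M. a k * u ^ k) = (\<Sum>k<M. b k * u ^ k)"
  shows "\<forall>k<M. a k = b k"
proof (rule ccontr)
  assume "\<not> ?thesis"
  then have ex: "\<exists>k. k < M \<and> a k \<noteq> b k" by auto
  \<comment> \<open>Every term after the first differing index \<open>m\<close> has order at least
    \<open>m * v u + 1\<close>, hence so has the term at \<open>m\<close> itself. Dividing by
    \<open>u ^ m\<close> puts the difference of the two digits into the maximal ideal, which the
    digit condition forbids.\<close>
  define m where "m = (LEAST k. k < M \<and> a k \<noteq> b k)"
  have m: "m < M" "a m \<noteq> b m"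
    using LeastI_ex[OF ex] by (auto simp: m_def)
  have less: "a k = b k" if "k < m" for k
    using not_less_Least[of k "\<lambda>k. k < M \<and> a k \<noteq> b k"] that m(1) by (auto simp: m_def)
  have "(\<Sum>k<M. (a k - b k) * u ^ k) = 0"
    using eq by (simp add: left_diff_distrib sum_subtractf)
  moreover have "(\<Sum>k<M. (a k - b k) * u ^ k) = (a m - b m) * u ^ m + (\<Sum>k\<in>{..<M}-{m}. (a k - b k) * u ^ k)"
    using m(1) by (subst sum.remove[of _ m]) auto
  ultimately have "(a m - b m) * u ^ m = - (\<Sum>k\<in>{..<M}-{m}. (a k - b k) * u ^ k)"
    by (simp add: eq_neg_iff_add_eq_0)
  moreover have "(\<Sum>k\<in>{..<M}-{m}. (a k - b k) * u ^ k) \<in> val_ge v (int m * v u + 1)"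
  proof (rule val_ge_sum)
    fix k assume k: "k \<in> {..<M}-{m}"
    show "(a k - b k) * u ^ k \<in> val_ge v (int m * v u + 1)"
    proof (cases "k < m")
      case True
      then show ?thesis using less by (simp add: val_ge_def)
    next
      case False
      then have "k \<ge> m + 1" using k by auto
      then have "int k * v u \<ge> (int m + 1) * v u"
        using u(2) by (intro mult_right_mono) auto
      then have "int m * v u + 1 \<le> 0 + int k * v u"
        using u(2) by (simp add: algebra_simps)
      moreover have "(a k - b k) * u ^ k \<in> val_ge v (0 + int k * v u)"
        using dig[of k] k u by (intro val_ge_mult val_ge_diff) (auto simp: val_ge_def v_power)
      ultimately show ?thesis using val_ge_mono by blast
    qed
  qed
  ultimately have "(a m - b m) * u ^ m \<in> val_ge v (int m * v u + 1)"
    using val_ge_minus by simp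
  then have "u ^ m * (a m - b m) \<in> val_ge v (v (u ^ m) + 1)"
    using u by (simp add: v_power mult.commute)
  then have "a m - b m \<in> val_ge v 1"
    using val_ge_mult_iff[of "u ^ m" "a m - b m" 1] u(1) by simp
  then show False using dig[OF m(1)] m(2) by auto
qed

end

section \<open>Finiteness of residue fields\<close>

text \<open>If the residue field of \<open>v\<close> were infinite, or if \<open>v\<close> were trivial on \<open>F(x)\<close>, then there would
  be more digit sums than combinations of a finite basis over \<open>F(x)\<close> whose coefficients are
  polynomials in \<open>x\<close> of suitably bounded degree.\<close>

definition polys_lt :: "'a \<Rightarrow> nat \<Rightarrow> 'a set" where
  "polys_lt x R = (\<lambda>c. \<Sum>i<R. c i * x ^ i) ` ({..<R} \<rightarrow>\<^sub>E F)"

lemma polys_lt_iff: "y \<in> polys_lt x R \<longleftrightarrow> (\<exists>c. (\<forall>i<R. c i \<in> F) \<and> y = (\<Sum>i<R. c i * x ^ i))"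
proof
  assume "\<exists>c. (\<forall>i<R. c i \<in> F) \<and> y = (\<Sum>i<R. c i * x ^ i)"
  then obtain c where c: "\<forall>i<R. c i \<in> F" "y = (\<Sum>i<R. c i * x ^ i)" by blast
  then have "restrict c {..<R} \<in> {..<R} \<rightarrow>\<^sub>E F" "y = (\<Sum>i<R. restrict c {..<R} i * x ^ i)"
    by auto
  then show "y \<in> polys_lt x R" unfolding polys_lt_def by blast
qed (auto simp: polys_lt_def)

lemma finite_polys_lt: "finite (polys_lt x R)"
  and card_polys_lt: "card (polys_lt x R) \<le> card F ^ R"
proof -
  have fin: "finite ({..<R} \<rightarrow>\<^sub>E F)"
    using finite_F by (simp add: finite_PiE)
  then show "finite (polys_lt x R)" by (simp add: polys_lt_def)
  show "card (polys_lt x R) \<le> card F ^ R"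
    unfolding polys_lt_def using card_image_le[OF fin] by (rule le_trans) (simp add: card_PiE)
qed

lemma polys_lt_poly:
  assumes "\<forall>i. coeff p i \<in> F" "degree p < R"
  shows "poly p x \<in> polys_lt x R"
proof -
  have "poly p x = (\<Sum>i<R. coeff p i * x ^ i)"
    unfolding poly_altdef using assms(2)
    by (intro sum.mono_neutral_left) (auto simp: coeff_eq_0)
  then show ?thesis using assms(1) by (auto simp: polys_lt_iff)
qed

text \<open>Needed for products. The clause for \<open>R = 0\<close> compensates for truncated
  subtraction: \<open>degree p \<le> R - 1\<close> alone would still admit the constants.\<close>

lemma polys_lt_eq: "polys_lt x R = {poly p x |p. (\<forall>i. coeff p i \<in> F) \<and> (R = 0 \<longrightarrow> p = 0) \<and> degree p \<le> R - 1}"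
proof (intro equalityI subsetI)
  fix y assume "y \<in> polys_lt x R"
  then obtain c where c: "\<forall>i<R. c i \<in> F" "y = (\<Sum>i<R. c i * x ^ i)"
    by (auto simp: polys_lt_iff)
  define p where "p = (\<Sum>i<R. monom (c i) i)"
  have cf: "coeff p i = (if i < R then c i else 0)" for i
    by (simp add: p_def coeff_sum)
  have "poly p x = y"
    by (simp add: p_def c poly_sum poly_monom)
  moreover have "\<forall>i. coeff p i \<in> F" using c F_closed(1) by (simp add: cf)
  moreover have "R = 0 \<longrightarrow> p = 0" by (simp add: p_def)
  moreover have "degree p \<le> R - 1" by (rule degree_le) (auto simp: cf)
  ultimately show "y \<in> {poly p x |p. (\<forall>i. coeff p i \<in> F) \<and> (R = 0 \<longrightarrow> p = 0) \<and> degree p \<le> R - 1}"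
    by blast
next
  fix y assume "y \<in> {poly p x |p. (\<forall>i. coeff p i \<in> F) \<and> (R = 0 \<longrightarrow> p = 0) \<and> degree p \<le> R - 1}"
  then obtain p where p: "y = poly p x" "\<forall>i. coeff p i \<in> F" "R = 0 \<longrightarrow> p = 0" "degree p \<le> R - 1"
    by blast
  show "y \<in> polys_lt x R"
  proof (cases "R = 0")
    case True
    then show ?thesis using p by (simp add: polys_lt_iff)
  next
    case False
    then show ?thesis using p by (auto intro: polys_lt_poly)
  qed
qed

lemma F_sum: "(\<And>i. i \<in> I \<Longrightarrow> h i \<in> F) \<Longrightarrow> sum h I \<in> F"
  by (induction I rule: infinite_finite_induct) (auto intro: F_closed(1,7))

lemma polys_lt_mono: "R \<le> R' \<Longrightarrow> polys_lt x R \<subseteq> polys_lt x R'"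
  unfolding polys_lt_eq by (clarsimp, rule_tac x = p in exI) auto

lemma polys_lt_add: "y \<in> polys_lt x R \<Longrightarrow> z \<in> polys_lt x R \<Longrightarrow> y + z \<in> polys_lt x R"
  unfolding polys_lt_iff
  by (elim exE conjE, rule_tac x = "\<lambda>i. c i + ca i" in exI)
     (auto simp: F_closed sum.distrib distrib_right)

lemma polys_lt_zero: "0 \<in> polys_lt x R"
  unfolding polys_lt_iff by (rule exI[of _ "\<lambda>_. 0"]) (simp add: F_closed)

lemma polys_lt_mult:
  assumes "y \<in> polys_lt x R" "z \<in> polys_lt x S"
  shows "y * z \<in> polys_lt x (R + S)"
proof -
  obtain p r where p: "y = poly p x" "\<forall>i. coeff p i \<in> F" "R = 0 \<longrightarrow> p = 0" "degree p \<le> R - 1"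
    and r: "z = poly r x" "\<forall>i. coeff r i \<in> F" "S = 0 \<longrightarrow> r = 0" "degree r \<le> S - 1"
    using assms unfolding polys_lt_eq by blast
  have "\<forall>i. coeff (p * r) i \<in> F"
    using p(2) r(2) by (auto simp: coeff_mult intro!: F_sum F_closed)
  moreover have "degree (p * r) \<le> R + S - 1"
  proof (cases "R = 0 \<or> S = 0")
    case True
    then show ?thesis using p(3) r(3) by auto
  next
    case False
    then show ?thesis using degree_mult_le[of p r] p(4) r(4) by linarith
  qed
  ultimately show ?thesis
    unfolding polys_lt_eq using p r by (intro CollectI exI[of _ "p * r"]) auto
qed

text \<open>The extra \<open>1\<close> in the bound accommodates the power \<open>0\<close>, since
  the constant 1 needs one coefficient.\<close>

lemma polys_lt_power: "y \<in> polys_lt x R \<Longrightarrow> y ^ n \<in> polys_lt x (n * R + 1)"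
proof (induction n)
  case 0
  show ?case unfolding polys_lt_iff by (rule exI[of _ "\<lambda>_. 1"]) (simp add: F_closed)
next
  case (Suc n)
  then show ?case using polys_lt_mult[of y x R "y ^ n" "n * R + 1"] by (simp add: add.assoc)
qed

text \<open>The coefficient set is not a field here; \<open>span_over\<close> is reused because
  \<open>finite_card_span_over\<close> counts combinations over any finite set.\<close>

definition poly_comb :: "'a \<Rightarrow> 'a set \<Rightarrow> nat \<Rightarrow> 'a set" where
  "poly_comb x B R = span_over (polys_lt x R) B"

lemma poly_comb_iff:
  "y \<in> poly_comb x B R \<longleftrightarrow> (\<exists>c. (\<forall>b\<in>B. c b \<in> polys_lt x R) \<and> y = (\<Sum>b\<in>B. c b * b))"
  by (auto simp: poly_comb_def span_over_def)

lemma card_poly_comb: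
  assumes "finite B"
  shows "finite (poly_comb x B R)" "card (poly_comb x B R) \<le> card F ^ (R * card B)"
proof -
  show "finite (poly_comb x B R)"
    unfolding poly_comb_def by (intro finite_card_span_over finite_polys_lt assms)
  have "card (poly_comb x B R) \<le> card (polys_lt x R) ^ card B"
    unfolding poly_comb_def by (intro finite_card_span_over finite_polys_lt assms)
  also have "\<dots> \<le> (card F ^ R) ^ card B"
    by (intro power_mono card_polys_lt) simp
  finally show "card (poly_comb x B R) \<le> card F ^ (R * card B)"
    by (simp add: power_mult)
qed

lemma poly_comb_add:
  "y \<in> poly_comb x B R \<Longrightarrow> z \<in> poly_comb x B R \<Longrightarrow> y + z \<in> poly_comb x B R"
  unfolding poly_comb_iff
  by (elim exE conjE, rule_tac x = "\<lambda>i. c i + ca i" in exI)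
     (auto simp: polys_lt_add sum.distrib distrib_right)

lemma poly_comb_zero: "0 \<in> poly_comb x B R"
  unfolding poly_comb_iff by (rule exI[of _ "\<lambda>_. 0"]) (simp add: polys_lt_zero)

lemma poly_comb_sum: "(\<And>i. i \<in> I \<Longrightarrow> h i \<in> poly_comb x B R) \<Longrightarrow> sum h I \<in> poly_comb x B R"
  by (induction I rule: infinite_finite_induct) (auto intro: poly_comb_add poly_comb_zero)

lemma poly_comb_mult:
  assumes "s \<in> polys_lt x S" "y \<in> poly_comb x B R"
  shows "s * y \<in> poly_comb x B (S + R)"
proof -
  obtain c where c: "\<forall>b\<in>B. c b \<in> polys_lt x R" "y = (\<Sum>b\<in>B. c b * b)"
    using assms(2) by (auto simp: poly_comb_iff)
  then have "s * y = (\<Sum>b\<in>B. (s * c b) * b)"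
    by (simp add: sum_distrib_left mult.assoc)
  then show ?thesis
    unfolding poly_comb_iff using c(1) assms(1) by (intro exI[of _ "\<lambda>b. s * c b"]) (auto intro: polys_lt_mult)
qed

section \<open>Rational functions in \<open>x\<close> and common denominators\<close>

lemma simple_ext_iff:
  "y \<in> simple_ext F x \<longleftrightarrow> (\<exists>R. \<exists>a\<in>polys_lt x R. \<exists>d\<in>polys_lt x R. d \<noteq> 0 \<and> y = a / d)"
proof
  assume "y \<in> simple_ext F x"
  then obtain p r where p: "y = poly p x / poly r x" "\<forall>i. coeff p i \<in> F" "\<forall>i. coeff r i \<in> F"
    "poly r x \<noteq> 0"
    by (auto simp: simple_ext_def)
  let ?R = "degree p + degree r + 1"
  have "poly p x \<in> polys_lt x ?R" "poly r x \<in> polys_lt x ?R"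
    using p by (auto intro: polys_lt_poly)
  then show "\<exists>R. \<exists>a\<in>polys_lt x R. \<exists>d\<in>polys_lt x R. d \<noteq> 0 \<and> y = a / d"
    using p by blast
next
  assume "\<exists>R. \<exists>a\<in>polys_lt x R. \<exists>d\<in>polys_lt x R. d \<noteq> 0 \<and> y = a / d"
  then show "y \<in> simple_ext F x"
    unfolding simple_ext_def polys_lt_eq by blast
qed

lemma common_denominator:
  assumes "finite Y" "Y \<subseteq> simple_ext F x"
  shows "\<exists>d R. d \<noteq> 0 \<and> d \<in> polys_lt x R \<and> (\<forall>y\<in>Y. d * y \<in> polys_lt x R)"
  using assms
proof (induction rule: finite_induct)
  case empty
  have "1 \<in> polys_lt x 1"
    unfolding polys_lt_iff by (rule exI[of _ "\<lambda>_. 1"]) (simp add: F_closed)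
  then show ?case using one_neq_zero by blast
next
  case (insert y Y)
  then obtain d R where d: "d \<noteq> 0" "d \<in> polys_lt x R" "\<forall>y\<in>Y. d * y \<in> polys_lt x R" by auto
  obtain S a e where e: "a \<in> polys_lt x S" "e \<in> polys_lt x S" "e \<noteq> 0" "y = a / e"
    using insert.prems by (auto simp: simple_ext_iff)
  have "e * d \<in> polys_lt x (S + R)" "\<forall>y\<in>Y. (e * d) * y \<in> polys_lt x (S + R)"
    using d e by (auto simp: mult.assoc intro: polys_lt_mult)
  moreover have "(e * d) * y \<in> polys_lt x (S + R)"
    using polys_lt_mult[OF e(1) d(2)] e by (simp add: mult.commute)
  moreover have "e * d \<noteq> 0" using d e by simp
  ultimately show ?case by blast
qed

text \<open>Finitely many functions have finitely many coordinates with respect to \<open>B\<close>.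
  Clearing all their denominators at once places the functions, up to the factor \<open>d\<close>,
  in one finite set whose size can be compared with others.\<close>

lemma common_denominator_span:
  assumes B: "finite B" "span_over (simple_ext F x) B = UNIV" and "finite Y"
  shows "\<exists>d R. d \<noteq> 0 \<and> (\<forall>y\<in>Y. d * y \<in> poly_comb x B R)"
proof -
  have "\<forall>y. \<exists>c. (\<forall>b\<in>B. c b \<in> simple_ext F x) \<and> y = (\<Sum>b\<in>B. c b * b)"
  proof
    fix y
    have "y \<in> span_over (simple_ext F x) B" by (simp add: B(2))
    then show "\<exists>c. (\<forall>b\<in>B. c b \<in> simple_ext F x) \<and> y = (\<Sum>b\<in>B. c b * b)"
      by (auto simp: span_over_def)
  qed
  then obtain c where c: "\<And>y b. b \<in> B \<Longrightarrow> c y b \<in> simple_ext F x" "\<And>y. y = (\<Sum>b\<in>B. c y b * b)"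
    by metis
  have "finite (case_prod c ` (Y \<times> B))" "case_prod c ` (Y \<times> B) \<subseteq> simple_ext F x"
    using B(1) assms(3) c(1) by auto
  from common_denominator[OF this] obtain d R where
    d: "d \<noteq> 0" "\<And>y b. y \<in> Y \<Longrightarrow> b \<in> B \<Longrightarrow> d * c y b \<in> polys_lt x R"
    by fastforce
  have "d * y \<in> poly_comb x B R" if "y \<in> Y" for y
  proof -
    have "d * y = (\<Sum>b\<in>B. (d * c y b) * b)"
      by (subst c(2)[of y]) (simp add: sum_distrib_left mult.assoc)
    then show ?thesis
      using d(2)[OF that] unfolding poly_comb_iff by (intro exI[of _ "\<lambda>b. d * c y b"]) auto
  qed
  then show ?thesis using d(1) by blast
qed

section \<open>Counting digit sums at a point\<close>

lemma card_polys_lt_transcendental: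
  assumes "\<not> algebraic_over F x"
  shows "card (polys_lt x R) = card F ^ R"
proof -
  have "inj_on (\<lambda>c. \<Sum>i<R. c i * x ^ i) ({..<R} \<rightarrow>\<^sub>E F)"
  proof (rule inj_onI)
    fix c e assume ce: "c \<in> {..<R} \<rightarrow>\<^sub>E F" "e \<in> {..<R} \<rightarrow>\<^sub>E F"
      and eq: "(\<Sum>i<R. c i * x ^ i) = (\<Sum>i<R. e i * x ^ i)"
    define p where "p = (\<Sum>i<R. monom (c i - e i) i)"
    have cf: "coeff p i = (if i < R then c i - e i else 0)" for i
      by (simp add: p_def coeff_sum)
    have "poly p x = 0"
      using eq by (simp add: p_def poly_sum poly_monom left_diff_distrib sum_subtractf)
    moreover have "\<forall>i. coeff p i \<in> F"
      using ce by (auto simp: cf intro!: F_closed)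
    ultimately have "p = 0" using assms by (auto simp: algebraic_over_def)
    then have "c i = e i" if "i < R" for i
      using cf[of i] that by simp
    then show "c = e" using ce by (intro PiE_ext) auto
  qed
  then show ?thesis by (simp add: polys_lt_def card_image card_PiE)
qed

text \<open>If \<open>v\<close> were trivial on \<open>F(x)\<close>, polynomials in \<open>x\<close>
  could serve as digits to the base of a uniformizer \<open>t\<close>. Sums of \<open>n + 1\<close>
  such digits would inject into combinations of only \<open>n\<close> generators, with degrees
  larger by a constant \<open>D\<close>.\<close>

lemma valuation_nontrivial_on_simple_ext:
  assumes v: "v \<in> points F" and x: "\<not> algebraic_over F x"
    and B: "finite B" "span_over (simple_ext F x) B = UNIV"
  shows "\<exists>R a d. a \<in> polys_lt x R \<and> d \<in> polys_lt x R \<and> a \<noteq> 0 \<and> d \<noteq> 0 \<and> v (a / d) \<ge> 1"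
proof (rule ccontr)
  assume neg: "\<not> ?thesis"
  \<comment> \<open>Neither \<open>a / 1\<close> nor \<open>1 / a\<close> can have positive
    order.\<close>
  have triv: "v a = 0" if a: "a \<in> polys_lt x R" "a \<noteq> 0" for a R
  proof -
    have one: "1 \<in> polys_lt x 1"
      unfolding polys_lt_iff by (rule exI[of _ "\<lambda>_. 1"]) (simp add: F_closed)
    have "a \<in> polys_lt x (R + 1)" "1 \<in> polys_lt x (R + 1)"
      using a(1) one polys_lt_mono[of R "R + 1" x] polys_lt_mono[of 1 "R + 1" x] by auto
    then have "\<not> v (a / 1) \<ge> 1" "\<not> v (1 / a) \<ge> 1"
      using neg a(2) by (metis one_neq_zero)+
    then show ?thesis
      using v_divide[OF v, of 1 a] v_one[OF v] a(2) by simp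
  qed
  obtain t where t: "t \<noteq> 0" "v t = 1" using v_uniformizer[OF v] by blast
  define n where "n = card B"
  obtain d D where d: "d \<noteq> 0" "\<And>k. k < n + 1 \<Longrightarrow> d * t ^ k \<in> poly_comb x B D"
    using common_denominator_span[OF B, of "(\<lambda>k. t ^ k) ` {..<n+1}"] by auto
  \<comment> \<open>The count yields \<open>R * (n + 1) \<le> (R + D) * n\<close>, that is
    \<open>R \<le> n * D\<close>; this is the least \<open>R\<close> for which it fails.\<close>
  define R where "R = n * D + 1"
  let ?X = "{..<n+1} \<rightarrow>\<^sub>E polys_lt x R"
  let ?f = "\<lambda>c. d * (\<Sum>k<n+1. c k * t ^ k)"
  have inj: "inj_on ?f ?X"
  proof (rule inj_onI)
    fix a b assume a: "a \<in> ?X" and b: "b \<in> ?X" and eq: "?f a = ?f b"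
    have "\<forall>k<n+1. a k = b k"
    proof (rule digit_sums_distinct[OF v t(1)])
      show "v t \<ge> 1" using t by simp
      show "(\<Sum>k<n+1. a k * t ^ k) = (\<Sum>k<n+1. b k * t ^ k)" using eq d(1) by simp
      fix k assume k: "k < n + 1"
      have ak: "a k \<in> polys_lt x R" "b k \<in> polys_lt x R" using a b k by (auto dest: PiE_mem)
      have "- b k \<in> polys_lt x R"
        using ak(2) unfolding polys_lt_iff
        by (elim exE conjE, rule_tac x = "\<lambda>i. - c i" in exI) (auto simp: F_closed sum_negf)
      then have "a k - b k \<in> polys_lt x R" using polys_lt_add[OF ak(1)] by fastforce
      then have "a k - b k \<noteq> 0 \<longrightarrow> v (a k - b k) = 0" using triv by blast
      moreover have "a k \<noteq> 0 \<longrightarrow> v (a k) = 0" "b k \<noteq> 0 \<longrightarrow> v (b k) = 0"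
        using triv ak by blast+
      ultimately show "a k \<in> val_ge v 0 \<and> b k \<in> val_ge v 0 \<and> (a k - b k \<in> val_ge v 1 \<longrightarrow> a k = b k)"
        unfolding val_ge_def by force
    qed
    then show "a = b" using a b by (intro PiE_ext) auto
  qed
  have "?f ` ?X \<subseteq> poly_comb x B (R + D)"
  proof clarify
    fix c assume c: "c \<in> ?X"
    have "?f c = (\<Sum>k<n+1. c k * (d * t ^ k))"
      by (simp add: sum_distrib_left algebra_simps)
    also have "\<dots> \<in> poly_comb x B (R + D)"
      using c d(2) by (intro poly_comb_sum poly_comb_mult) (auto dest: PiE_mem)
    finally show "?f c \<in> poly_comb x B (R + D)" .
  qed
  then have "card ?X \<le> card (poly_comb x B (R + D))"
    by (rule card_inj_on_le[OF inj _ card_poly_comb(1)[OF B(1)]])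
  also have "\<dots> \<le> card F ^ ((R + D) * n)"
    unfolding n_def by (rule card_poly_comb(2)[OF B(1)])
  also have "card ?X = card F ^ (R * (n + 1))"
    by (simp add: card_PiE card_polys_lt_transcendental[OF x] power_mult[symmetric] power_add[symmetric] algebra_simps)
  finally have "R * (n + 1) \<le> (R + D) * n"
    using card_F_gt_1 by simp
  then show False by (simp add: R_def algebra_simps)
qed

text \<open>An infinite residue field would supply arbitrarily large digit sets \<open>Y\<close>.
  The base \<open>a / e\<close> is taken from \<open>F(x)\<close>, so that clearing the denominators
  of \<open>M\<close>-digit sums costs degree only linear in \<open>M\<close>; the number
  \<open>card Y ^ M\<close> of sums then outgrows the space containing them.\<close>

lemma residue_finite:
  assumes v: "v \<in> points F"
  shows "\<exists>Y. finite Y \<and> Y \<subseteq> local_ring v \<and> (\<forall>x\<in>local_ring v. \<exists>y\<in>Y. x - y \<in> max_ideal v)"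
proof (rule ccontr)
  assume neg: "\<not> ?thesis"
  \<comment> \<open>The set grows greedily: a finite \<open>Y\<close> that misses a residue class
    can be enlarged by an element of that class.\<close>
  have ex: "\<exists>Y. finite Y \<and> card Y = N \<and> Y \<subseteq> val_ge v 0 \<and> (\<forall>y\<in>Y. \<forall>z\<in>Y. y - z \<in> val_ge v 1 \<longrightarrow> y = z)"
    for N
  proof (induction N)
    case (Suc N)
    then obtain Y where Y: "finite Y" "card Y = N" "Y \<subseteq> val_ge v 0"
      "\<forall>y\<in>Y. \<forall>z\<in>Y. y - z \<in> val_ge v 1 \<longrightarrow> y = z" by blast
    obtain x where x: "x \<in> val_ge v 0" "\<forall>y\<in>Y. x - y \<notin> val_ge v 1"
      using neg Y by (auto simp: local_ring_eq[OF v] max_ideal_eq[OF v])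
    have x': "\<forall>y\<in>Y. y - x \<notin> val_ge v 1"
      using x(2) val_ge_minus[OF v] by (metis minus_diff_eq)
    have "x \<notin> Y" using x(2) by (force simp: val_ge_def)
    then show ?case
      using Y x x' by (intro exI[of _ "insert x Y"]) auto
  qed auto
  obtain x B where x: "\<not> algebraic_over F x" and B: "finite B" "span_over (simple_ext F x) B = UNIV"
    using curve by (auto simp: curve_over_def)
  obtain E a e where E: "a \<in> polys_lt x E" "e \<in> polys_lt x E" "a \<noteq> 0" "e \<noteq> 0" "v (a / e) \<ge> 1"
    using valuation_nontrivial_on_simple_ext[OF v x B] by blast
  define n where "n = card B"
  \<comment> \<open>The power of \<open>card F\<close> cancels the growth of the bound in
    \<open>M\<close>, and the factor 2 leaves \<open>2 ^ M\<close> against a constant.\<close>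
  obtain Y where Y: "finite Y" "card Y = 2 * card F ^ (2 * E * n)" "Y \<subseteq> val_ge v 0"
    "\<forall>y\<in>Y. \<forall>z\<in>Y. y - z \<in> val_ge v 1 \<longrightarrow> y = z" using ex by blast
  obtain d D where d: "d \<noteq> 0" "\<And>y. y \<in> Y \<Longrightarrow> d * y \<in> poly_comb x B D"
    using common_denominator_span[OF B Y(1)] by blast
  have bound: "card Y ^ M \<le> card F ^ ((2 * M * E + 2 + D) * n)" for M
  proof -
    let ?X = "{..<M} \<rightarrow>\<^sub>E Y"
    \<comment> \<open>The factor \<open>e ^ M\<close> turns \<open>(a / e) ^ k\<close> into the
      polynomial \<open>a ^ k * e ^ (M - k)\<close>, while \<open>d\<close> clears the denominators
      of the digits.\<close>
    let ?f = "\<lambda>c. d * e ^ M * (\<Sum>k<M. c k * (a / e) ^ k)"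
    have inj: "inj_on ?f ?X"
    proof (rule inj_onI)
      fix b c assume b: "b \<in> ?X" and c: "c \<in> ?X" and eq: "?f b = ?f c"
      have "\<forall>k<M. b k = c k"
      proof (rule digit_sums_distinct[OF v _ E(5)])
        show "a / e \<noteq> 0" using E by simp
        show "(\<Sum>k<M. b k * (a / e) ^ k) = (\<Sum>k<M. c k * (a / e) ^ k)" using eq d(1) E(4) by simp
        fix k assume k: "k < M"
        have "b k \<in> Y" "c k \<in> Y" using b c k by (auto dest: PiE_mem)
        then show "b k \<in> val_ge v 0 \<and> c k \<in> val_ge v 0 \<and> (b k - c k \<in> val_ge v 1 \<longrightarrow> b k = c k)"
          using Y by auto
      qed
      then show "b = c" using b c by (intro PiE_ext) auto
    qed
    have "?f ` ?X \<subseteq> poly_comb x B (2 * M * E + 2 + D)"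
    proof clarify
      fix c assume c: "c \<in> ?X"
      have "?f c = (\<Sum>k<M. (a ^ k * e ^ (M - k)) * (d * c k))"
        using E(4) by (auto simp: sum_distrib_left power_divide power_diff intro!: sum.cong)
      also have "\<dots> \<in> poly_comb x B (2 * M * E + 2 + D)"
      proof (rule poly_comb_sum)
        fix k assume k: "k \<in> {..<M}"
        have "(k * E + 1) + ((M - k) * E + 1) \<le> 2 * M * E + 2"
          using k by (simp add: add_mult_distrib[symmetric])
        then have "a ^ k * e ^ (M - k) \<in> polys_lt x (2 * M * E + 2)"
          using polys_lt_mult[OF polys_lt_power[OF E(1), of k] polys_lt_power[OF E(2), of "M - k"]]
            polys_lt_mono by blast
        then show "(a ^ k * e ^ (M - k)) * (d * c k) \<in> poly_comb x B (2 * M * E + 2 + D)"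
          using c k d(2) by (intro poly_comb_mult) (auto dest: PiE_mem)
      qed
      finally show "?f c \<in> poly_comb x B (2 * M * E + 2 + D)" .
    qed
    then have "card ?X \<le> card (poly_comb x B (2 * M * E + 2 + D))"
      by (rule card_inj_on_le[OF inj _ card_poly_comb(1)[OF B(1)]])
    also have "\<dots> \<le> card F ^ ((2 * M * E + 2 + D) * n)"
      unfolding n_def by (rule card_poly_comb(2)[OF B(1)])
    finally show ?thesis by (simp add: card_PiE)
  qed
  define Z where "Z = card F ^ ((2 + D) * n)"
  have "2 ^ M \<le> Z" for M
  proof -
    have "2 ^ M * (card F ^ (2 * E * n)) ^ M \<le> Z * (card F ^ (2 * E * n)) ^ M"
      using bound[of M] unfolding Y(2) Z_def
      by (simp add: power_mult_distrib power_mult[symmetric] power_add[symmetric] algebra_simps)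
    then show ?thesis using card_F_gt_1 by simp
  qed
  \<comment> \<open>The bound holds for every \<open>M\<close>; taking \<open>M = Z\<close>
    contradicts \<open>Z < 2 ^ Z\<close>.\<close>
  then have "2 ^ Z \<le> Z" .
  then show False using less_exp[of Z] by simp
qed

text \<open>Finiteness of the residue field provides some finite spanning set, so the minimum in
  \<open>quot_dim\<close> is attained.\<close>

lemma point_degree_spanning:
  assumes v: "v \<in> points F"
  obtains B where "B \<subseteq> local_ring v" "finite B" "card B = point_degree F v"
    "\<forall>x\<in>local_ring v. \<exists>s\<in>span_over F B. x - s \<in> max_ideal v"
proof -
  obtain Y where Y: "finite Y" "Y \<subseteq> local_ring v" "\<forall>x\<in>local_ring v. \<exists>y\<in>Y. x - y \<in> max_ideal v"
    using residue_finite[OF v] by blast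
  let ?Q = "\<lambda>n. \<exists>B. B \<subseteq> local_ring v \<and> finite B \<and> card B = n \<and>
     (\<forall>x\<in>local_ring v. \<exists>s\<in>span_over F B. x - s \<in> max_ideal v)"
  have "\<forall>x\<in>local_ring v. \<exists>s\<in>span_over F Y. x - s \<in> max_ideal v"
    using Y(3) span_over_superset[OF subfield_F Y(1)] by (meson subsetD)
  then have "?Q (card Y)"
    using Y(1,2) by (intro exI[of _ Y]) simp
  then have "?Q (point_degree F v)"
    unfolding point_degree_def quot_dim_def by (rule LeastI)
  then show ?thesis using that by blast
qed

lemma point_degree_pos:
  assumes v: "v \<in> points F"
  shows "point_degree F v > 0"
proof -
  obtain B where B: "finite B" "card B = point_degree F v"
    "\<forall>x\<in>local_ring v. \<exists>s\<in>span_over F B. x - s \<in> max_ideal v"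
    by (rule point_degree_spanning[OF v])
  have "1 \<in> local_ring v" by (simp add: local_ring_def v_one[OF v])
  then obtain s where s: "s \<in> span_over F B" "1 - s \<in> max_ideal v" using B(3) by blast
  have "B \<noteq> {}"
  proof
    assume "B = {}"
    then have "s = 0" using s(1) by (auto simp: span_over_def)
    then show False using s(2) by (simp add: max_ideal_def v_one[OF v])
  qed
  then show ?thesis using B(1,2) by (metis card_gt_0_iff)
qed

section \<open>Divisors and Riemann--Roch spaces\<close>

lemma v_surj:
  assumes v: "v \<in> points F"
  shows "\<exists>z. z \<noteq> 0 \<and> v z = n"
proof -
  obtain t where t: "t \<noteq> 0" "v t = 1" using v_uniformizer[OF v] by blast
  show ?thesis
  proof (cases "n \<ge> 0")
    case True
    then have "v (t ^ nat n) = n" using t v_power[OF v] by simp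
    then show ?thesis using t(1) by (intro exI[of _ "t ^ nat n"]) simp
  next
    case False
    then have "v (inverse (t ^ nat (- n))) = n" using t v_power[OF v] v_inverse[OF v] by simp
    then show ?thesis using t(1) by (intro exI[of _ "inverse (t ^ nat (- n))"]) simp
  qed
qed

lemma supp_diff: "supp (D - E) \<subseteq> supp D \<union> supp E"
  and supp_add: "supp (D + E) \<subseteq> supp D \<union> supp E"
  by (auto simp: supp_def)

lemma divisors_diff: "D \<in> divisors F \<Longrightarrow> E \<in> divisors F \<Longrightarrow> D - E \<in> divisors F"
  unfolding divisors_def using supp_diff[of D E] finite_subset[OF supp_diff[of D E]] by auto

lemma divisors_add: "D \<in> divisors F \<Longrightarrow> E \<in> divisors F \<Longrightarrow> D + E \<in> divisors F"
  unfolding divisors_def using supp_add[of D E] finite_subset[OF supp_add[of D E]] by auto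

lemma supp_point_div: "supp (point_div Q) = {Q}"
  by (auto simp: supp_def point_div_def)

lemma point_div_divisors: "Q \<in> points F \<Longrightarrow> point_div Q \<in> divisors F"
  by (simp add: divisors_def supp_point_div)

section \<open>Degrees and induction over effective divisors\<close>

lemma div_degree_superset:
  assumes "finite T" "supp D \<subseteq> T"
  shows "div_degree F D = (\<Sum>v\<in>T. D v * int (point_degree F v))"
  unfolding div_degree_def using assms by (intro sum.mono_neutral_left) (auto simp: supp_def)

lemma div_degree_add:
  assumes "finite (supp D)" "finite (supp E)"
  shows "div_degree F (D + E) = div_degree F D + div_degree F E"
  using assms supp_add[of D E] div_degree_superset[of "supp D \<union> supp E"]
  by (simp add: sum.distrib distrib_right)

lemma div_degree_diff:
  assumes "finite (supp D)" "finite (supp E)"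
  shows "div_degree F (D - E) = div_degree F D - div_degree F E"
  using assms supp_diff[of D E] div_degree_superset[of "supp D \<union> supp E"]
  by (simp add: sum_subtractf left_diff_distrib)

lemma div_degree_point: "div_degree F (point_div Q) = int (point_degree F Q)"
  by (simp add: div_degree_def supp_point_div) (simp add: point_div_def)

lemma div_degree_scale:
  assumes "finite (supp D)"
  shows "div_degree F (\<lambda>v. k * D v) = k * div_degree F D"
proof -
  have "supp (\<lambda>v. k * D v) \<subseteq> supp D" by (auto simp: supp_def)
  then show ?thesis
    using assms div_degree_superset[of "supp D"] by (simp add: sum_distrib_left mult.assoc)
qed

text \<open>\<open>D\<close> is built up one point at a time, by induction on the unweighted sum of
  its coefficients. Only points of \<open>supp D\<close> are added, so a property known at these
  points alone suffices for the step.\<close>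

lemma effective_induct:
  fixes D :: "'a divisor"
  assumes fin: "finite (supp D)" and D: "0 \<le> D" and zero: "Z 0"
    and step: "\<And>E Q. 0 \<le> E \<Longrightarrow> supp E \<subseteq> supp D \<Longrightarrow> Q \<in> supp D \<Longrightarrow> Z E \<Longrightarrow> Z (E + point_div Q)"
  shows "Z D"
proof -
  have "Z E" if "0 \<le> E" "supp E \<subseteq> supp D" "(\<Sum>v\<in>supp D. E v) = int n" for n E
    using that
  proof (induction n arbitrary: E)
    case 0
    then have "\<forall>v\<in>supp D. E v = 0"
      using fin by (simp add: sum_nonneg_eq_0_iff le_fun_def)
    then have "E = 0" using 0(2) by (auto simp: supp_def fun_eq_iff)
    then show ?case using zero by (simp only:)
  next
    case (Suc n)
    have "\<exists>Q\<in>supp D. E Q > 0"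
    proof (rule ccontr)
      assume "\<not> ?thesis"
      then have "(\<Sum>v\<in>supp D. E v) \<le> 0" by (intro sum_nonpos) (auto simp: not_less)
      then show False using Suc.prems(3) by simp
    qed
    then obtain Q where Q: "Q \<in> supp D" "E Q > 0" by blast
    define E' where "E' = E - point_div Q"
    have E': "0 \<le> E'" "supp E' \<subseteq> supp D"
      using Suc.prems(1,2) Q by (auto simp: E'_def le_fun_def supp_def point_div_def split: if_splits)
    have "(\<Sum>v\<in>supp D. E' v) = int n"
      using Suc.prems(3) fin Q(1) by (simp add: E'_def sum_subtractf point_div_def)
    then have "Z (E' + point_div Q)" using E' Q(1) Suc.IH step by blast
    then show ?case by (simp add: E'_def)
  qed
  moreover have "(\<Sum>v\<in>supp D. D v) = int (nat (\<Sum>v\<in>supp D. D v))"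
    using D by (simp add: sum_nonneg le_fun_def)
  ultimately show ?thesis using D by blast
qed

section \<open>Riemann-Roch spaces as intersections of local conditions\<close>

lemma RR_iff:
  assumes "E \<in> divisors F"
  shows "f \<in> RR_space F E \<longleftrightarrow> (\<forall>v\<in>points F. f \<in> val_ge v (- E v))"
proof (cases "f = 0")
  case True
  then show ?thesis by (simp add: RR_space_def val_ge_def)
next
  case False
  have out: "E v = 0" if "v \<notin> points F" for v
    using assms that by (auto simp: divisors_def supp_def)
  have "f \<in> RR_space F E \<longleftrightarrow> (\<forall>v. 0 \<le> principal_div F f v + E v)"
    using False by (simp add: RR_space_def le_fun_def)
  also have "\<dots> \<longleftrightarrow> (\<forall>v\<in>points F. f \<in> val_ge v (- E v))"
    using False out by (auto simp: principal_div_def val_ge_def)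
  finally show ?thesis .
qed

lemma RR_zero: "0 \<in> RR_space F E"
  by (simp add: RR_space_def)

lemma RR_add:
  assumes "E \<in> divisors F" "f \<in> RR_space F E" "h \<in> RR_space F E"
  shows "f + h \<in> RR_space F E"
  using assms by (simp add: RR_iff val_ge_add)

lemma RR_diff:
  assumes "E \<in> divisors F" "f \<in> RR_space F E" "h \<in> RR_space F E"
  shows "f - h \<in> RR_space F E"
  using assms by (simp add: RR_iff val_ge_diff)

lemma RR_scale:
  assumes "E \<in> divisors F" "f \<in> RR_space F E" "c \<in> F"
  shows "c * f \<in> RR_space F E"
proof -
  have "c * f \<in> val_ge v (- E v)" if v: "v \<in> points F" for v
    using val_ge_mult[OF v val_ge_const[OF v assms(3)], of f "- E v"] assms(2) v
    by (simp add: RR_iff[OF assms(1)])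
  then show ?thesis by (simp add: RR_iff[OF assms(1)])
qed

lemma RR_mult:
  assumes "D \<in> divisors F" "E \<in> divisors F" "f \<in> RR_space F D" "h \<in> RR_space F E"
  shows "f * h \<in> RR_space F (D + E)"
proof -
  have "f * h \<in> val_ge v (- (D + E) v)" if v: "v \<in> points F" for v
    using val_ge_mult[OF v, of f "- D v" h "- E v"] assms(3,4) v
    by (simp add: RR_iff assms(1,2))
  then show ?thesis by (simp add: RR_iff[OF divisors_add[OF assms(1,2)]])
qed

lemma RR_mono:
  assumes "D \<in> divisors F" "E \<in> divisors F" "D \<le> E"
  shows "RR_space F D \<subseteq> RR_space F E"
proof
  fix f assume f: "f \<in> RR_space F D"
  show "f \<in> RR_space F E"
    unfolding RR_iff[OF assms(2)]
  proof
    fix v assume v: "v \<in> points F"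
    have "- E v \<le> - D v" using assms(3) by (simp add: le_fun_def)
    moreover have "f \<in> val_ge v (- D v)" using f v by (simp add: RR_iff[OF assms(1)])
    ultimately show "f \<in> val_ge v (- E v)" using val_ge_mono[OF v] by blast
  qed
qed

lemma minus_point_le: "E - point_div Q \<le> (E :: 'a divisor)"
  by (simp add: le_fun_def point_div_def)

lemma RR_minus_point_iff:
  assumes E: "E \<in> divisors F" and Q: "Q \<in> points F"
  shows "f \<in> RR_space F (E - point_div Q) \<longleftrightarrow> f \<in> RR_space F E \<and> f \<in> val_ge Q (1 - E Q)"
proof -
  have E': "E - point_div Q \<in> divisors F" using E Q by (intro divisors_diff point_div_divisors)
  have "f \<in> val_ge v (- (E - point_div Q) v) \<longleftrightarrow> f \<in> val_ge v (- E v) \<and> (v = Q \<longrightarrow> f \<in> val_ge Q (1 - E Q))"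
    for v by (auto simp: point_div_def val_ge_def)
  then show ?thesis using Q by (auto simp: RR_iff[OF E] RR_iff[OF E'])
qed

text \<open>The two spaces are nested, so they differ exactly when some function attains the extreme
  order \<open>- E Q\<close> at \<open>Q\<close>. Later arguments work with this witness.\<close>

lemma Gamma_pt_iff:
  assumes Q: "Q \<in> points F"
  shows "E \<in> Gamma_pt F Q \<longleftrightarrow> E \<in> divisors F \<and> (\<exists>f. f \<noteq> 0 \<and> f \<in> RR_space F E \<and> Q f = - E Q)"
proof (cases "E \<in> divisors F")
  case True
  have "E \<in> Gamma_pt F Q \<longleftrightarrow> (\<exists>f\<in>RR_space F E. f \<notin> val_ge Q (1 - E Q))"
    using RR_minus_point_iff[OF True Q] True by (auto simp: Gamma_pt_def)
  also have "\<dots> \<longleftrightarrow> (\<exists>f. f \<noteq> 0 \<and> f \<in> RR_space F E \<and> Q f = - E Q)"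
  proof -
    have "f \<notin> val_ge Q (1 - E Q) \<longleftrightarrow> f \<noteq> 0 \<and> Q f = - E Q" if "f \<in> RR_space F E" for f
    proof -
      have "f \<in> val_ge Q (- E Q)" using that Q by (simp add: RR_iff[OF True])
      then show ?thesis by (auto simp: val_ge_def)
    qed
    then show ?thesis by blast
  qed
  finally show ?thesis using True by blast
qed (simp add: Gamma_pt_def)

text \<open>The semigroup property: witnesses multiply and their orders at \<open>Q\<close>
  add.\<close>

lemma Gamma_pt_add:
  assumes Q: "Q \<in> points F" and "D \<in> Gamma_pt F Q" "E \<in> Gamma_pt F Q"
  shows "D + E \<in> Gamma_pt F Q"
proof -
  obtain f h where f: "D \<in> divisors F" "f \<noteq> 0" "f \<in> RR_space F D" "Q f = - D Q"
    and h: "E \<in> divisors F" "h \<noteq> 0" "h \<in> RR_space F E" "Q h = - E Q"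
    using assms(2,3) by (auto simp: Gamma_pt_iff[OF Q])
  have "f * h \<noteq> 0" "f * h \<in> RR_space F (D + E)" "Q (f * h) = - (D + E) Q"
    using f h RR_mult v_mult[OF Q] by auto
  then show ?thesis using f(1) h(1) divisors_add unfolding Gamma_pt_iff[OF Q] by blast
qed

text \<open>Multiplication by \<open>z\<close> of order \<open>E Q\<close> moves \<open>L(E)\<close>
  into the local ring at \<open>Q\<close>. Functions with equal residue representative then differ
  by an element of \<open>L(E - Q)\<close>, and a spanning set of size \<open>deg Q\<close> limits
  the representatives.\<close>

lemma card_RR_minus_point:
  assumes E: "E \<in> divisors F" and Q: "Q \<in> points F"
    and fin: "finite (RR_space F (E - point_div Q))"
  shows "card (RR_space F E) \<le> card F ^ point_degree F Q * card (RR_space F (E - point_div Q))"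
proof -
  obtain B where B: "finite B" "card B = point_degree F Q"
    "\<forall>x\<in>local_ring Q. \<exists>s\<in>span_over F B. x - s \<in> max_ideal Q"
    using point_degree_spanning[OF Q] by metis
  obtain z where z: "z \<noteq> 0" "Q z = E Q" using v_surj[OF Q] by blast
  have "\<forall>f\<in>RR_space F E. \<exists>s\<in>span_over F B. z * f - s \<in> val_ge Q 1"
  proof
    fix f assume "f \<in> RR_space F E"
    then have "f \<in> val_ge Q (- E Q)" using Q by (simp add: RR_iff[OF E])
    then have "z * f \<in> val_ge Q 0" using val_ge_mult_iff[OF Q z(1), of f "- E Q"] z(2) by simp
    then show "\<exists>s\<in>span_over F B. z * f - s \<in> val_ge Q 1"
      using B(3) by (simp add: local_ring_eq[OF Q] max_ideal_eq[OF Q])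
  qed
  then obtain \<phi> where \<phi>: "\<And>f. f \<in> RR_space F E \<Longrightarrow> \<phi> f \<in> span_over F B"
    "\<And>f. f \<in> RR_space F E \<Longrightarrow> z * f - \<phi> f \<in> val_ge Q 1"
    by metis
  have "card (RR_space F E) \<le> card (span_over F B) * card (RR_space F (E - point_div Q))"
  proof (rule card_le_cosets(2)[where \<phi> = \<phi>])
    show "finite (span_over F B)" using finite_card_span_over finite_F B(1) by blast
    show "\<phi> ` RR_space F E \<subseteq> span_over F B" using \<phi>(1) by blast
    fix f h assume fh: "f \<in> RR_space F E" "h \<in> RR_space F E" "\<phi> f = \<phi> h"
    have "(z * f - \<phi> f) - (z * h - \<phi> h) \<in> val_ge Q 1"
      using val_ge_diff[OF Q \<phi>(2)[OF fh(1)] \<phi>(2)[OF fh(2)]] .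
    then have "z * (f - h) \<in> val_ge Q 1" using fh(3) by (simp add: algebra_simps)
    then have "f - h \<in> val_ge Q (1 - E Q)"
      using val_ge_mult_iff[OF Q z(1), of "f - h" "1 - E Q"] z(2) by simp
    then show "f - h \<in> RR_space F (E - point_div Q)"
      using fh RR_diff[OF E] by (simp add: RR_minus_point_iff[OF E Q])
  qed (rule fin)
  also have "\<dots> \<le> card F ^ point_degree F Q * card (RR_space F (E - point_div Q))"
    using finite_card_span_over(2)[OF finite_F B(1)] B(2) by (intro mult_right_mono) auto
  finally show ?thesis .
qed

text \<open>A finite \<open>V\<close> spans itself. This crude bound suffices where only boundedness
  of the dimension matters.\<close>

lemma quot_dim_le_card: "finite V \<Longrightarrow> quot_dim F V {0} \<le> card V"
  unfolding quot_dim_def using span_over_superset[OF subfield_F, of V]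
  by (intro Least_le exI[of _ V]) auto

text \<open>Over a finite \<open>F\<close> a finite set spans only finitely many functions, so the
  predicate under \<open>LEAST\<close> is never satisfied. Its value is unspecified, but the same
  for every infinite \<open>V\<close>.\<close>

lemma quot_dim_infinite:
  assumes "infinite V"
  shows "quot_dim F V {0} = (LEAST n. False)"
proof -
  have "\<not> (\<forall>x\<in>V. \<exists>s\<in>span_over F B. x - s \<in> {0})" if "finite B" for B
  proof
    assume "\<forall>x\<in>V. \<exists>s\<in>span_over F B. x - s \<in> {0}"
    then have "V \<subseteq> span_over F B" by auto
    then show False
      using assms finite_card_span_over(1)[OF finite_F that] finite_subset by blast
  qed
  then have "(\<exists>B. B \<subseteq> V \<and> finite B \<and> card B = n \<and> (\<forall>x\<in>V. \<exists>s\<in>span_over F B. x - s \<in> {0})) = False" for n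
    by blast
  then show ?thesis unfolding quot_dim_def by (intro arg_cong[where f = Least] ext)
qed

end

section \<open>Consequences of Riemann's inequality\<close>

locale pointed_curve = function_field F for F :: "'a::field set" +
  fixes g :: nat and P :: "'a \<Rightarrow> int"
  assumes genus: "has_genus F g" and rational: "rational_point F P"
begin

lemma P_point: "P \<in> points F" and P_degree: "point_degree F P = 1"
  using rational by (auto simp: rational_point_def)

lemma riemann: "E \<in> divisors F \<Longrightarrow> div_degree F E - int (quot_dim F (RR_space F E) {0}) + 1 \<le> int g"
  using genus by (simp add: has_genus_def)

text \<open>An infinite \<open>L(E)\<close> would force the junk value of \<open>quot_dim\<close> on all \<open>L(E + nP)\<close>, contradicting
  Riemann's inequality for large \<open>n\<close>.\<close>

lemma finite_RR:
  assumes E: "E \<in> divisors F"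
  shows "finite (RR_space F E)"
proof (rule ccontr)
  assume inf: "infinite (RR_space F E)"
  define E' where "E' n = E + (\<lambda>v. int n * point_div P v)" for n
  have nP: "(\<lambda>v. int n * point_div P v) \<in> divisors F" for n
    using P_point by (auto simp: divisors_def supp_def point_div_def)
  have "div_degree F E + int n - int (LEAST n. False) + 1 \<le> int g" for n
  proof -
    have E'd: "E' n \<in> divisors F" unfolding E'_def by (intro divisors_add E nP)
    have "RR_space F E \<subseteq> RR_space F (E' n)"
      by (rule RR_mono[OF E E'd]) (simp add: E'_def le_fun_def point_div_def)
    then have "infinite (RR_space F (E' n))" using inf finite_subset by blast
    moreover have "div_degree F (E' n) = div_degree F E + int n"
      using E nP[of n] div_degree_scale[of "point_div P" "int n"]
      by (simp add: E'_def div_degree_add divisors_def supp_point_div div_degree_point P_degree)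
    ultimately show ?thesis using riemann[OF E'd] by (simp add: quot_dim_infinite)
  qed
  \<comment> \<open>For this \<open>n\<close> the left-hand side is at least
    \<open>g + 1\<close>.\<close>
  from this[of "nat (int g + int (LEAST n. False) - div_degree F E)"] show False by linarith
qed

lemma card_RR_pos: "E \<in> divisors F \<Longrightarrow> card (RR_space F E) > 0"
  using finite_RR[of E] RR_zero[of E] by (auto simp: card_gt_0_iff)

lemma card_RR_mult_le:
  assumes "B \<in> divisors F" "E \<in> divisors F" "f \<noteq> 0" "f \<in> RR_space F B"
  shows "card (RR_space F E) \<le> card (RR_space F (E + B))"
proof (rule card_inj_on_le[of "\<lambda>h. f * h"])
  show "inj_on (\<lambda>h. f * h) (RR_space F E)" using assms(3) by (auto simp: inj_on_def)
  show "(\<lambda>h. f * h) ` RR_space F E \<subseteq> RR_space F (E + B)"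
    using RR_mult[OF assms(1,2,4)] by (auto simp: add.commute)
  show "finite (RR_space F (E + B))" using assms by (intro finite_RR divisors_add)
qed

text \<open>If \<open>deg B\<close> were negative, then the divisors \<open>-nB\<close> would have unbounded degree, while
  multiplication by powers of a function in \<open>L(B)\<close> embeds all \<open>L(-nB)\<close> into \<open>L(0)\<close>.\<close>

lemma div_degree_nonneg:
  assumes B: "B \<in> divisors F" and f: "f \<noteq> 0" "f \<in> RR_space F B"
  shows "div_degree F B \<ge> 0"
proof (rule ccontr)
  assume neg: "\<not> ?thesis"
  define E where "E n = (\<lambda>v. (- int n) * B v)" for n
  have Ed: "E n \<in> divisors F" for n
    using B by (auto simp: divisors_def supp_def E_def)
  have bound: "card (RR_space F (E n)) \<le> card (RR_space F 0)" for n
  proof (induction n)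
    case 0
    have "E 0 = 0" by (simp add: E_def fun_eq_iff)
    then show ?case by simp
  next
    case (Suc n)
    \<comment> \<open>Hence multiplication by \<open>f\<close> embeds each space of the sequence
      into the preceding one.\<close>
    have "E (Suc n) + B = E n" by (simp add: E_def fun_eq_iff algebra_simps)
    then show ?case using card_RR_mult_le[OF B Ed f, of "Suc n"] Suc.IH by simp
  qed
  have "int n \<le> int g + int (card (RR_space F 0))" for n
  proof -
    have "int (quot_dim F (RR_space F (E n)) {0}) \<le> int (card (RR_space F 0))"
      using quot_dim_le_card[OF finite_RR[OF Ed[of n]]] bound[of n] by linarith
    moreover have "div_degree F (E n) = - int n * div_degree F B"
      unfolding E_def using B by (intro div_degree_scale) (simp add: divisors_def)
    moreover have "int n * 1 \<le> int n * (- div_degree F B)"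
      using neg by (intro mult_left_mono) auto
    ultimately show ?thesis using riemann[OF Ed[of n]] by simp
  qed
  from this[of "g + card (RR_space F 0) + 1"] show False by simp
qed

text \<open>Any divisor \<open>D \<le> B'\<close> satisfies \<open>f \<in> L(B - D)\<close>, so
  \<open>deg D \<le> deg B\<close> because \<open>deg (B - D)\<close> is nonnegative. This forces
  \<open>B'\<close> to have finite support, and then \<open>D = B'\<close> gives the degree
  bound.\<close>

lemma principal_add_effective:
  assumes B: "B \<in> divisors F" and f: "f \<noteq> 0" "f \<in> RR_space F B"
  defines "B' \<equiv> principal_div F f + B"
  shows "B' \<in> divisors F" "0 \<le> B'" "div_degree F B' \<le> div_degree F B"
proof -
  show eff: "0 \<le> B'" using f by (simp add: RR_space_def B'_def)
  have pts: "supp B' \<subseteq> points F"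
    using B by (auto simp: B'_def supp_def principal_div_def divisors_def split: if_splits)
  have sub: "f \<in> RR_space F (B - D)" if D: "D \<in> divisors F" "D \<le> B'" for D
  proof -
    have "D v \<le> B' v" for v using D(2) by (simp add: le_fun_def)
    then have *: "D v \<le> v f + B v" if "v \<in> points F" for v
      using that by (metis B'_def plus_fun_apply principal_div_def)
    have "\<forall>v\<in>points F. f \<in> val_ge v (- (B - D) v)"
      using * by (auto simp: val_ge_def diff_le_eq)
    then show ?thesis using RR_iff[OF divisors_diff[OF B D(1)]] by blast
  qed
  have le: "div_degree F D \<le> div_degree F B" if D: "D \<in> divisors F" "D \<le> B'" for D
    using div_degree_nonneg[OF divisors_diff[OF B D(1)] f(1) sub[OF D]] B D(1)
    by (simp add: div_degree_diff divisors_def)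
  have "finite (supp B')"
  proof (rule ccontr)
    assume "infinite (supp B')"
    \<comment> \<open>The sum of these points has degree at least \<open>card T\<close>, which
      exceeds \<open>deg B\<close>.\<close>
    then obtain T where T: "T \<subseteq> supp B'" "finite T" "card T = nat (div_degree F B) + 1"
      using infinite_arbitrarily_large by blast
    define D where "D = (\<lambda>v. if v \<in> T then 1 else 0 :: int)"
    have supp: "supp D = T" by (auto simp: D_def supp_def)
    have Dd: "D \<in> divisors F" using T pts supp by (auto simp: divisors_def)
    have "D v \<le> B' v" for v
    proof -
      have "0 \<le> B' v" using eff by (simp add: le_fun_def)
      moreover have "v \<in> T \<Longrightarrow> B' v \<noteq> 0" using T(1) by (auto simp: supp_def)
      ultimately show ?thesis by (auto simp: D_def)
    qed
    then have "D \<le> B'" by (simp add: le_fun_def)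
    then have "div_degree F D \<le> div_degree F B" using le Dd by blast
    moreover have "div_degree F D \<ge> (\<Sum>v\<in>T. 1)"
      unfolding div_degree_def supp
    proof (rule sum_mono)
      fix v assume "v \<in> T"
      then have "point_degree F v > 0" "D v = 1"
        using T(1) pts point_degree_pos by (auto simp: D_def)
      then show "1 \<le> D v * int (point_degree F v)" by simp
    qed
    ultimately show False using T(3) by (simp split: if_splits)
  qed
  then show B'd: "B' \<in> divisors F" using pts by (simp add: divisors_def)
  show "div_degree F B' \<le> div_degree F B" using le[OF B'd] by simp
qed

text \<open>Removing the points of \<open>D\<close> one after another costs a factor of at most
  \<open>card F ^ point_degree F Q\<close> for each \<open>Q\<close>.\<close>

lemma card_RR_minus_effective:
  assumes A: "A \<in> divisors F" and D: "D \<in> divisors F" "0 \<le> D"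
  shows "card (RR_space F A) \<le> card F ^ nat (div_degree F D) * card (RR_space F (A - D))"
proof -
  have fin: "finite (supp D)" and pts: "supp D \<subseteq> points F" using D(1) by (auto simp: divisors_def)
  have deg0: "div_degree F E \<ge> 0" if "0 \<le> E" for E
    unfolding div_degree_def using that by (intro sum_nonneg mult_nonneg_nonneg) (auto simp: le_fun_def)
  show ?thesis
    using fin D(2)
  proof (rule effective_induct)
    show "card (RR_space F A) \<le> card F ^ nat (div_degree F 0) * card (RR_space F (A - 0))"
      using card_F_gt_1 by simp
  next
    fix E Q assume E: "0 \<le> E" "supp E \<subseteq> supp D" and Q: "Q \<in> supp D"
      and IH: "card (RR_space F A) \<le> card F ^ nat (div_degree F E) * card (RR_space F (A - E))"
    have Ed: "E \<in> divisors F" using E fin pts finite_subset by (auto simp: divisors_def)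
    have Qp: "Q \<in> points F" using Q pts by blast
    have AE: "A - E \<in> divisors F" using A Ed by (rule divisors_diff)
    have "card (RR_space F (A - E)) \<le> card F ^ point_degree F Q * card (RR_space F (A - E - point_div Q))"
      using AE Qp by (intro card_RR_minus_point finite_RR divisors_diff[of "A - E"] point_div_divisors)
    then have "card (RR_space F A) \<le> card F ^ nat (div_degree F E) *
        (card F ^ point_degree F Q * card (RR_space F (A - E - point_div Q)))"
      using IH by (meson le_trans mult_le_mono2)
    moreover have "nat (div_degree F (E + point_div Q)) = nat (div_degree F E) + point_degree F Q"
      using Ed deg0[OF E(1)]
      by (simp add: div_degree_add divisors_def supp_point_div div_degree_point nat_add_distrib)
    moreover have "A - E - point_div Q = A - (E + point_div Q)" by (simp add: fun_eq_iff)
    ultimately show "card (RR_space F A) \<le> card F ^ nat (div_degree F (E + point_div Q)) *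
        card (RR_space F (A - (E + point_div Q)))"
      by (simp add: power_add mult.assoc)
  qed
qed

text \<open>Division by \<open>f\<close> embeds \<open>L(A - B')\<close> into
  \<open>L(A - B)\<close> for the effective divisor \<open>B' = (f) + B\<close>, which reduces the
  claim to the effective case.\<close>

lemma card_RR_minus:
  assumes A: "A \<in> divisors F" and B: "B \<in> divisors F" and f: "f \<noteq> 0" "f \<in> RR_space F B"
  shows "card (RR_space F A) \<le> card F ^ nat (div_degree F B) * card (RR_space F (A - B))"
proof -
  define B' where "B' = principal_div F f + B"
  note B' = principal_add_effective[OF B f, folded B'_def]
  have dd: "A - B \<in> divisors F" "A - B' \<in> divisors F" using A B B'(1) by (auto intro: divisors_diff)
  have "card (RR_space F (A - B')) \<le> card (RR_space F (A - B))"
  proof (rule card_inj_on_le[of "\<lambda>h. h / f"])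
    show "inj_on (\<lambda>h. h / f) (RR_space F (A - B'))" using f(1) by (auto simp: inj_on_def)
    show "finite (RR_space F (A - B))" by (rule finite_RR[OF dd(1)])
    show "(\<lambda>h. h / f) ` RR_space F (A - B') \<subseteq> RR_space F (A - B)"
    proof clarify
      fix h assume h: "h \<in> RR_space F (A - B')"
      have "h / f \<in> val_ge v (- (A - B) v)" if v: "v \<in> points F" for v
      proof -
        have "f * (h / f) \<in> val_ge v (v f + - (A - B) v)"
          using h v f(1) unfolding RR_iff[OF dd(2)] by (auto simp: B'_def principal_div_def algebra_simps)
        then show ?thesis using val_ge_mult_iff[OF v f(1)] by blast
      qed
      then show "h / f \<in> RR_space F (A - B)" by (simp add: RR_iff[OF dd(1)])
    qed
  qed
  then have "card (RR_space F A) \<le> card F ^ nat (div_degree F B') * card (RR_space F (A - B))"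
    using card_RR_minus_effective[OF A B'(1,2)] by (meson le_trans mult_le_mono2)
  also have "\<dots> \<le> card F ^ nat (div_degree F B) * card (RR_space F (A - B))"
    using B'(3) card_F_gt_1 by (intro mult_right_mono power_increasing) auto
  finally show ?thesis .
qed

section \<open>The ratio of Riemann--Roch spaces\<close>

text \<open>With \<open>q = card F\<close> this is \<open>q\<close> to the power
  \<open>dim L(A) - dim L(A - B)\<close>; using cardinalities replaces dimension arguments by
  injections and fibre counts.\<close>

definition RR_ratio :: "'a divisor \<Rightarrow> 'a divisor \<Rightarrow> real" where
  "RR_ratio B A = real (card (RR_space F A)) / real (card (RR_space F (A - B)))"

lemma RR_ratio_le:
  assumes "A \<in> divisors F" "B \<in> divisors F" "f \<noteq> 0" "f \<in> RR_space F B"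
  shows "RR_ratio B A \<le> real (card F) ^ nat (div_degree F B)"
proof -
  have "real (card (RR_space F A)) \<le> real (card F ^ nat (div_degree F B) * card (RR_space F (A - B)))"
    using card_RR_minus[OF assms] by (simp only: of_nat_le_iff)
  then show ?thesis
    using card_RR_pos[OF divisors_diff[OF assms(1,2)]] by (simp add: RR_ratio_def pos_divide_le_eq)
qed

lemma RR_ratio_ge_1:
  assumes "A \<in> divisors F" "B \<in> divisors F" "f \<noteq> 0" "f \<in> RR_space F B"
  shows "RR_ratio B A \<ge> 1"
proof -
  have "card (RR_space F (A - B)) \<le> card (RR_space F A)"
    using card_RR_mult_le[OF assms(2) divisors_diff[OF assms(1,2)] assms(3,4)] by simp
  then show ?thesis
    using card_RR_pos[OF divisors_diff[OF assms(1,2)]] by (simp add: RR_ratio_def)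
qed

text \<open>The embedding of quotients is counted through the map
  \<open>(y, h) \<mapsto> f * y + h\<close> from \<open>L(A' - B) \<times> L(A)\<close> to
  \<open>L(A')\<close>, whose fibres are no larger than \<open>L(A - B)\<close>.\<close>

lemma RR_ratio_add_point:
  assumes A: "A \<in> divisors F" and Q: "Q \<in> points F" and BQ: "B \<in> Gamma_pt F Q"
  shows "RR_ratio B A \<le> RR_ratio B (A + point_div Q)"
proof -
  obtain f where B: "B \<in> divisors F" and f: "f \<noteq> 0" "f \<in> RR_space F B" "Q f = - B Q"
    using BQ by (auto simp: Gamma_pt_iff[OF Q])
  define A' where "A' = A + point_div Q"
  have A'd: "A' \<in> divisors F" unfolding A'_def using A Q by (intro divisors_add point_div_divisors)
  have dd: "A - B \<in> divisors F" "A' - B \<in> divisors F" using A A'd B by (auto intro: divisors_diff)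
  have eq: "A' - point_div Q = A" "A' - B - point_div Q = A - B" by (auto simp: A'_def fun_eq_iff)
  have sub: "RR_space F A \<subseteq> RR_space F A'"
    using minus_point_le[of A' Q] eq(1) A A'd by (intro RR_mono) auto
  have "card (RR_space F (A' - B) \<times> RR_space F A) \<le> card (RR_space F A') * card (RR_space F (A - B) \<times> {0::'a})"
  proof (rule card_le_fibres(2)[where \<phi> = "\<lambda>(y, h). f * y + h"])
    show "finite (RR_space F A')" by (rule finite_RR[OF A'd])
    show "(\<lambda>(y, h). f * y + h) ` (RR_space F (A' - B) \<times> RR_space F A) \<subseteq> RR_space F A'"
      using RR_mult[OF B dd(2) f(2)] RR_add[OF A'd] sub by auto
    fix t
    let ?X = "{x \<in> RR_space F (A' - B) \<times> RR_space F A. (\<lambda>(y, h). f * y + h) x = t}"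
    have fin: "finite ?X" using finite_RR[OF dd(2)] finite_RR[OF A] by simp
    have "card ?X \<le> card (RR_space F (A - B) \<times> {0::'a})"
    proof (cases "?X = {}")
      case False
      then obtain y0 h0 where y0: "y0 \<in> RR_space F (A' - B)" "h0 \<in> RR_space F A" "f * y0 + h0 = t"
        by auto
      show ?thesis
      \<comment> \<open>Within a fibre \<open>y\<close> determines \<open>h\<close>, so the second
        component can be collapsed to \<open>0\<close>; the singleton factor does not change the
        count.\<close>
      proof (rule card_inj_on_le[of "\<lambda>(y, h). (y - y0, 0)"])
        show "inj_on (\<lambda>(y, h). (y - y0, 0::'a)) ?X" by (auto simp: inj_on_def)
        show "finite (RR_space F (A - B) \<times> {0::'a})" using finite_RR[OF dd(1)] by simp
        show "(\<lambda>(y, h). (y - y0, 0)) ` ?X \<subseteq> RR_space F (A - B) \<times> {0::'a}"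
        proof (rule image_subsetI)
          fix x assume "x \<in> ?X"
          then obtain y h where x: "x = (y, h)"
            and y: "y \<in> RR_space F (A' - B)" "h \<in> RR_space F A" "f * y + h = t"
            by auto
          have "f * (y - y0) = h0 - h" using y0(3) y(3) by (simp add: algebra_simps)
          then have "f * (y - y0) \<in> RR_space F (A' - point_div Q)"
            using RR_diff[OF A y0(2) y(2)] eq(1) by simp
          then have "f * (y - y0) \<in> val_ge Q (1 - A' Q)"
            by (simp add: RR_minus_point_iff[OF A'd Q])
          \<comment> \<open>As \<open>f\<close> has the exact order \<open>- B Q\<close>, the extra
            vanishing of the product at \<open>Q\<close> passes entirely to
            \<open>y - y0\<close>.\<close>
          then have "f * (y - y0) \<in> val_ge Q (Q f + (1 - (A' - B) Q))"
            using f(3) by simp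
          then have "y - y0 \<in> val_ge Q (1 - (A' - B) Q)"
            using val_ge_mult_iff[OF Q f(1)] by blast
          then have "y - y0 \<in> RR_space F (A - B)"
            using RR_diff[OF dd(2) y(1) y0(1)] RR_minus_point_iff[OF dd(2) Q] eq(2) by simp
          then show "(\<lambda>(y, h). (y - y0, 0)) x \<in> RR_space F (A - B) \<times> {0::'a}"
            by (simp add: x)
        qed
      qed
    next
      case True
      show ?thesis by (simp only: True) simp
    qed
    then show "finite ?X \<and> card ?X \<le> card (RR_space F (A - B) \<times> {0::'a})" using fin by blast
  qed
  then have "card (RR_space F (A' - B)) * card (RR_space F A) \<le> card (RR_space F A') * card (RR_space F (A - B))"
    by (simp add: card_cartesian_product)
  then have "real (card (RR_space F (A' - B))) * real (card (RR_space F A)) \<le>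
      real (card (RR_space F A')) * real (card (RR_space F (A - B)))"
    by (simp only: of_nat_le_iff of_nat_mult[symmetric])
  then show ?thesis
    using card_RR_pos[OF dd(1)] card_RR_pos[OF dd(2)]
    by (simp add: RR_ratio_def A'_def[symmetric] field_simps)
qed

lemma RR_ratio_mono:
  assumes A: "A \<in> divisors F" "A' \<in> divisors F" "A \<le> A'"
    and B: "\<And>Q. Q \<in> supp (A' - A) \<Longrightarrow> B \<in> Gamma_pt F Q"
  shows "RR_ratio B A \<le> RR_ratio B A'"
proof -
  have Dd: "A' - A \<in> divisors F" using A by (intro divisors_diff)
  then have fin: "finite (supp (A' - A))" and pts: "supp (A' - A) \<subseteq> points F"
    by (auto simp: divisors_def)
  have "0 \<le> A' - A" using A(3) by (simp add: le_fun_def)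
  with fin have "RR_ratio B A \<le> RR_ratio B (A + (A' - A))"
  proof (rule effective_induct)
    fix E Q assume E: "supp E \<subseteq> supp (A' - A)" and Q: "Q \<in> supp (A' - A)"
      and IH: "RR_ratio B A \<le> RR_ratio B (A + E)"
    have "E \<in> divisors F" using E fin pts finite_subset by (auto simp: divisors_def)
    then have "A + E \<in> divisors F" using A(1) by (intro divisors_add)
    moreover have "Q \<in> points F" using Q pts by blast
    ultimately have "RR_ratio B (A + E) \<le> RR_ratio B (A + E + point_div Q)"
      using B[OF Q] by (intro RR_ratio_add_point)
    then show "RR_ratio B A \<le> RR_ratio B (A + (E + point_div Q))"
      using IH by (simp add: add.assoc)
  qed simp
  then show ?thesis by simp
qed

text \<open>The denominator is the same at \<open>A - P\<close> and at \<open>A\<close>, since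
  \<open>A - B\<close> is not in \<open>Gamma_pt F P\<close>. The numerator grows by
  \<open>card F\<close>: for \<open>f\<close> of exact order at \<open>P\<close>, the constant
  multiples of \<open>f\<close> lie in distinct cosets of \<open>L(A - P)\<close>.\<close>

lemma RR_ratio_jump:
  assumes A: "A \<in> Gamma_pt F P" and B: "B \<in> divisors F" and AB: "A - B \<notin> Gamma_pt F P"
  shows "real (card F) * RR_ratio B (A - point_div P) \<le> RR_ratio B A"
proof -
  obtain f where Ad: "A \<in> divisors F" and f: "f \<noteq> 0" "f \<in> RR_space F A" "P f = - A P"
    using A by (auto simp: Gamma_pt_iff[OF P_point])
  have ABd: "A - B \<in> divisors F" using Ad B by (rule divisors_diff)
  have eq: "RR_space F (A - point_div P - B) = RR_space F (A - B)"
    using AB ABd by (simp add: Gamma_pt_def diff_diff_eq add.commute)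
  let ?H = "RR_space F (A - point_div P)"
  have Hd: "A - point_div P \<in> divisors F" using Ad P_point by (intro divisors_diff point_div_divisors)
  have sub: "?H \<subseteq> RR_space F A" using Hd Ad by (intro RR_mono minus_point_le)
  have "card (F \<times> ?H) \<le> card (RR_space F A)"
  proof (rule card_inj_on_le[of "\<lambda>(c, h). c * f + h"])
    show "finite (RR_space F A)" by (rule finite_RR[OF Ad])
    show "(\<lambda>(c, h). c * f + h) ` (F \<times> ?H) \<subseteq> RR_space F A"
      using RR_scale[OF Ad f(2)] RR_add[OF Ad] sub by auto
    show "inj_on (\<lambda>(c, h). c * f + h) (F \<times> ?H)"
    proof (rule inj_onI, clarify)
      fix c h c' h' assume c: "c \<in> F" "c' \<in> F" and h: "h \<in> ?H" "h' \<in> ?H"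
        and e: "c * f + h = c' * f + h'"
      have "(c - c') * f = h' - h" using e by (simp add: algebra_simps)
      then have "(c - c') * f \<in> ?H" using RR_diff[OF Hd h(2,1)] by simp
      then have in1: "(c - c') * f \<in> val_ge P (1 - A P)"
        by (simp add: RR_minus_point_iff[OF Ad P_point])
      have "c = c'"
      proof (rule ccontr)
        assume "c \<noteq> c'"
        then have "P (c - c') = 0" using v_const[OF P_point] F_closed(3)[OF c] by simp
        then have "P ((c - c') * f) = - A P" using v_mult[OF P_point] f(1,3) \<open>c \<noteq> c'\<close> by simp
        then show False using in1 f(1) \<open>c \<noteq> c'\<close> by (simp add: val_ge_def)
      qed
      then show "c = c' \<and> h = h'" using e by simp
    qed
  qed
  then have "real (card F * card ?H) \<le> real (card (RR_space F A))"
    by (simp only: card_cartesian_product of_nat_le_iff)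
  then show ?thesis
    by (simp add: RR_ratio_def eq divide_right_mono)
qed

text \<open>The ratio is followed along \<open>A 1 - P, A 1, A 2 - P, A 2, ..., A w\<close>. Each of
  the \<open>w\<close> steps from \<open>A i - P\<close> to \<open>A i\<close> gains a factor
  \<open>card F\<close>, and the segments between them lose nothing.\<close>

lemma chain_bound:
  assumes w: "w \<ge> 1" and C: "C \<in> divisors F"
    and Ad: "\<forall>i\<in>{1..w}. A i \<in> divisors F"
    and step: "\<forall>i\<in>{1..<w}. A (i + 1) \<ge> A i + point_div P"
    and Delta: "\<forall>i\<in>{1..w}. A i \<in> Delta_rel F P C"
    and B: "B \<in> Gamma_rel F P C" "B \<in> Gamma_set F (supp (A w - A 1))"
  shows "div_degree F B \<ge> int w"
proof -
  have BP: "B \<in> Gamma_pt F P" "B - C \<in> Gamma_pt F P" using B(1) by (auto simp: Gamma_rel_def)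
  obtain f where Bd: "B \<in> divisors F" and f: "f \<noteq> 0" "f \<in> RR_space F B"
    using BP(1) by (auto simp: Gamma_pt_iff[OF P_point])
  have AP: "A i \<in> Gamma_pt F P" "A i - B \<notin> Gamma_pt F P" if "i \<in> {1..w}" for i
  proof -
    show "A i \<in> Gamma_pt F P" using Delta that by (simp add: Delta_rel_def)
    show "A i - B \<notin> Gamma_pt F P"
    proof
      assume "A i - B \<in> Gamma_pt F P"
      then have "(A i - B) + (B - C) \<in> Gamma_pt F P" using BP(2) by (rule Gamma_pt_add[OF P_point])
      then show False using Delta that by (auto simp: Delta_rel_def)
    qed
  qed
  have step': "A i v + point_div P v \<le> A (i + 1) v" if "1 \<le> i" "i < w" for i v
    using step that by (auto simp: le_fun_def)
  have mono: "A i v \<le> A j v" if "1 \<le> i" "i \<le> j" "j \<le> w" for i j v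
    using that(2,3)
  proof (induction j rule: dec_induct)
    case (step j)
    then show ?case using step'[of j v] that(1) by (simp add: point_div_def split: if_splits)
  qed simp
  \<comment> \<open>A coefficient that is nonzero here means strict growth from \<open>A i\<close>
    to \<open>A (i + 1)\<close>, which monotonicity of the chain preserves in
    \<open>A w - A 1\<close>.\<close>
  have supp: "supp (A (i + 1) - point_div P - A i) \<subseteq> supp (A w - A 1)" if i: "1 \<le> i" "i < w" for i
  proof
    fix v assume v: "v \<in> supp (A (i + 1) - point_div P - A i)"
    have "A 1 v \<le> A i v" "A (i + 1) v \<le> A w v" using i mono[of 1 i v] mono[of "i+1" w v] by auto
    then show "v \<in> supp (A w - A 1)"
      using v step'[OF i, of v] by (auto simp: supp_def point_div_def split: if_splits)
  qed
  have "RR_ratio B (A i) \<ge> real (card F) ^ i" if "1 \<le> i" "i \<le> w" for i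
    using that
  proof (induction i rule: dec_induct)
    case base
    \<comment> \<open>Starting one point below \<open>A 1\<close>, where the ratio is at least 1,
      makes \<open>A 1\<close> itself contribute a factor; hence the exponent \<open>i\<close>
      instead of \<open>i - 1\<close>.\<close>
    have "A 1 - point_div P \<in> divisors F"
      using Ad w P_point by (intro divisors_diff point_div_divisors) auto
    then have "1 \<le> RR_ratio B (A 1 - point_div P)" using Bd f by (intro RR_ratio_ge_1)
    then have "real (card F) * 1 \<le> real (card F) * RR_ratio B (A 1 - point_div P)"
      by (intro mult_left_mono) auto
    also have "\<dots> \<le> RR_ratio B (A 1)"
      using w by (intro RR_ratio_jump AP Bd) auto
    finally show ?case by simp
  next
    case (step i)
    then have i: "1 \<le> i" "i < w" by auto
    have d: "A i \<in> divisors F" "A (i + 1) - point_div P \<in> divisors F"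
      using Ad i P_point by (auto intro!: divisors_diff point_div_divisors)
    have "A i \<le> A (i + 1) - point_div P"
      using step'[OF i] by (simp add: le_fun_def le_diff_eq)
    moreover have "B \<in> Gamma_pt F Q" if "Q \<in> supp (A (i + 1) - point_div P - A i)" for Q
      using B(2) supp[OF i] that by (auto simp: Gamma_set_def)
    ultimately have "RR_ratio B (A i) \<le> RR_ratio B (A (i + 1) - point_div P)"
      using d by (intro RR_ratio_mono)
    then have "real (card F) * real (card F) ^ i \<le> real (card F) * RR_ratio B (A (i + 1) - point_div P)"
      using step.IH i by (intro mult_left_mono) auto
    also have "\<dots> \<le> RR_ratio B (A (i + 1))"
      using i by (intro RR_ratio_jump AP Bd) auto
    finally show ?case by simp
  qed
  from this[of w] have "real (card F) ^ w \<le> RR_ratio B (A w)" using w by simp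
  also have "\<dots> \<le> real (card F) ^ nat (div_degree F B)"
    using Ad w Bd f by (intro RR_ratio_le) auto
  finally have "w \<le> nat (div_degree F B)" using card_F_gt_1 by simp
  \<comment> \<open>Because \<open>w \<ge> 1\<close>, the degree is positive and \<open>nat\<close>
    has not truncated it.\<close>
  then show ?thesis using w by linarith
qed

text \<open>The constant 1 is the witness at each \<open>Q\<close> in \<open>S\<close>: its order
  there is \<open>0 = - B Q\<close>.\<close>

lemma effective_Gamma_set:
  assumes B: "B \<in> divisors F" "0 \<le> B" and S: "S \<subseteq> points F" "supp B \<inter> S = {}"
  shows "B \<in> Gamma_set F S"
proof -
  have "0 \<le> B v" for v using B(2) by (simp add: le_fun_def)
  then have one: "1 \<in> RR_space F B" by (simp add: RR_iff[OF B(1)] val_ge_def v_one)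
  have "B \<in> Gamma_pt F Q" if "Q \<in> S" for Q
  proof -
    have Q: "Q \<in> points F" "B Q = 0" using that S by (auto simp: supp_def)
    then show ?thesis
      using B(1) one v_one[OF Q(1)] by (auto simp: Gamma_pt_iff[OF Q(1)] intro!: exI[of _ 1])
  qed
  then show ?thesis using B(1) by (simp add: Gamma_set_def)
qed

end

theorem theorem5p3:
  fixes F :: "'a::field set" and g w :: nat
    and C :: "'a divisor" and P :: "'a \<Rightarrow> int"
    and A :: "nat \<Rightarrow> 'a divisor"
  assumes "curve_over F" and "has_genus F g"
    and "C \<in> divisors F" and "rational_point F P"
    and "w \<ge> 1"
    and "\<forall>i\<in>{1..w}. A i \<in> divisors F"
    and "\<forall>i\<in>{1..<w}. A i \<le> A (i + 1)"
    and "\<forall>i\<in>{1..<w}. A (i + 1) \<ge> A i + point_div P"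
    and "\<forall>i\<in>{1..w}. A i \<in> Delta_rel F P C"
  shows "(\<forall>B\<in>Gamma_rel F P C. B \<ge> 0 \<and> supp B \<inter> supp (A w - A 1) = {} \<longrightarrow>
            div_degree F B \<ge> int w) \<and>
         gamma_min F P C (supp (A w - A 1)) \<ge> ereal (real w)"
proof -
  interpret pointed_curve F g P
    by unfold_locales (use assms in auto)
  let ?S = "supp (A w - A 1)"
  have bound: "div_degree F B \<ge> int w" if "B \<in> Gamma_rel F P C" "B \<in> Gamma_set F ?S" for B
    using chain_bound[OF assms(5,3,6,8,9) that] .
  have "A w - A 1 \<in> divisors F"
    using assms(5,6) by (intro divisors_diff) auto
  then have S: "?S \<subseteq> points F" by (simp add: divisors_def)
  show ?thesis
  proof (intro conjI ballI impI)
    fix B assume B: "B \<in> Gamma_rel F P C" and eff: "B \<ge> 0 \<and> supp B \<inter> ?S = {}"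
    have "B \<in> divisors F" using B by (simp add: Gamma_rel_def Gamma_pt_def)
    then show "div_degree F B \<ge> int w"
      using B eff S by (intro bound effective_Gamma_set) auto
  next
    show "gamma_min F P C ?S \<ge> ereal (real w)"
      unfolding gamma_min_def
    \<comment> \<open>A bound on every member suffices; over an empty set of divisors the infimum is
      infinite.\<close>
    proof (rule INF_greatest)
      fix B assume "B \<in> Gamma_rel F P C \<inter> Gamma_set F ?S"
      then have "int w \<le> div_degree F B" using bound by blast
      then have "real w \<le> real_of_int (div_degree F B)" by linarith
      then show "ereal (real w) \<le> ereal (real_of_int (div_degree F B))" by simp
    qed
  qed
qed

end
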